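(* Let $f\in\mathrm{LC}$ satisfy (A$_1$), (A$_2$), and (A$_3$) the fundamental matrix $\Phi$ of $\dot y=A(t)y$ with $\Phi(0)=I_N$ satisfies $\|\Phi(t)\Phi^{-1}(s)\|\le Ke^{-\alpha_1(t-s)}$ for $s\le t\le0$, for some $\alpha_1>0$, $K\ge1$; (A$_4$) $\sup_{t\in\mathbb R}\int_{-r}^r|b(s+t)|ds<\infty$ for every $r>0$. Then the process $S_f$ on $(\mathbb R^N)^+$ given by $S_f(t,s)x_0=x(t,f,s,x_0)$ is strongly pullback bounded dissipative on $(-\infty,\tau]$ for every $\tau\in\mathbb R$, and consequently it has a pullback attractor which is bounded in the past (i.e. $\bigcup_{t\le\tau}\mathcal A(t)$ is bounded for every $\tau$).
   Context: $\mathrm{LC}$: Borel measurable $f:\mathbb R\times\mathbb R^N\to\mathbb R^N$ such that for every compact $K$ there are $m^K,l^K\in L^1_{loc}$ with $|f(t,x)|\le m^K(t)$ and $|f(t,x)-f(t,y)|\le l^K(t)|x-y|$ for $x,y\in K$, a.e. $t$. $x(t,f,s,x_0)$ is the solution of $\dot x=f(t,x)$, $x(s)=x_0$. For $x\in\mathbb R^N$, $x\ge0$ means all components $x_i\ge0$; $(\mathbb R^N)^+=\{x\ge0\}$; vector inequalities are componentwise. (A$_1$): if $x\ge0$ and $x_i=0$, then $f_i(t,x)\ge0$ for a.e. $t$. (A$_2$): for a.e. $(t,x)\in\mathbb R\times(\mathbb R^N)^+$, $f(t,x)\le A(t)x+b(t)$, where $A=[a_{ij}]\in L^1_{loc}(\mathbb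 R^{N\times N})$ with $a_{ij}\ge0$ for $i\ne j$, and $b\in L^1_{loc}(\mathbb R^N)$ with $b(t)\ge0$ for all $t$. Under (A$_1$),(A$_2$), solutions with $x_0\in(\mathbb R^N)^+$ remain nonnegative and exist for all forward times, so $S_f$ is a process on $(\mathbb R^N)^+$. A family $\{B(t)\}_{t\in\mathbb R}$ of nonempty bounded sets is pullback absorbing for $S$ if for every $t$ and bounded $D$ there is $T(t,D)>0$ with $S(t,t-s)D\subset B(t)$ for $s\ge T(t,D)$. $S$ is strongly pullback bounded dissipative on $(-\infty,\tau]$ if there is a pullback absorbing family $\{B(t)\}$ such that for each bounded $D$ there is $T(\tau,D)>0$ with $S(t,t-s)D\subset B(\tau)$ for all $t\le\tau$, $s\ge T(\tau,D)$. A pullback attractor of a process $S$ is a family $\{\mathcal A(t)\}_{t\in\mathbb R}$ of compact sets with $S(t,s)\mathcal A(s)=\mathcal A(t)$ for $t\ge s$, $\lim_{s\to-\infty}\mathrm{dist}(S(t,s)D,\mathcal A(t))=0$ for every bounded $D$ and $t$ (Hausdorff semi-distance), and minimal among closed families with this property. *)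

theory Defs
  imports "HOL-Analysis.Analysis"
begin

definition nonneg :: "real^'n \<Rightarrow> bool" where
  "nonneg x \<longleftrightarrow> (\<forall>i. 0 \<le> x $ i)"

definition vle :: "real^'n \<Rightarrow> real^'n \<Rightarrow> bool" where
  "vle x y \<longleftrightarrow> (\<forall>i. x $ i \<le> y $ i)"

definition posorthant :: "(real^'n) set" where
  "posorthant = {x. nonneg x}"

definition LC :: "(real \<Rightarrow> real^'n \<Rightarrow> real^'n) \<Rightarrow> bool" where
  "LC f \<longleftrightarrow> (\<lambda>p. f (fst p) (snd p)) \<in> borel_measurable borel \<and>
    (\<forall>K. compact K \<longrightarrow> (\<exists>m l :: real \<Rightarrow> real.
       (\<forall>a c. set_integrable lborel {a..c} m) \<and> (\<forall>a c. set_integrable lborel {a..c} l) \<and>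
       (AE t in lborel. \<forall>x\<in>K. \<forall>y\<in>K. norm (f t x) \<le> m t \<and> norm (f t x - f t y) \<le> l t * norm (x - y))))"

definition cond_A1 :: "(real \<Rightarrow> real^'n \<Rightarrow> real^'n) \<Rightarrow> bool" where
  "cond_A1 f \<longleftrightarrow> (\<forall>x i. nonneg x \<and> x $ i = 0 \<longrightarrow> (AE t in lborel. 0 \<le> f t x $ i))"

definition is_solution :: "(real \<Rightarrow> real^'n \<Rightarrow> real^'n) \<Rightarrow> real \<Rightarrow> real^'n \<Rightarrow> real \<Rightarrow> (real \<Rightarrow> real^'n) \<Rightarrow> bool" where
  "is_solution f s x0 t x \<longleftrightarrow> s \<le> t \<and> continuous_on {s..t} x \<and>
    (\<forall>u\<in>{s..t}. set_integrable lborel {s..u} (\<lambda>r. f r (x r)) \<and>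
        x u = x0 + (LINT r:{s..u}|lborel. f r (x r)))"

definition Sf :: "(real \<Rightarrow> real^'n \<Rightarrow> real^'n) \<Rightarrow> real \<Rightarrow> real \<Rightarrow> real^'n \<Rightarrow> real^'n" where
  "Sf f t s x0 = (THE y. \<exists>x. is_solution f s x0 t x \<and> x t = y)"

definition fundamental_matrix :: "(real \<Rightarrow> real^'n^'n) \<Rightarrow> (real \<Rightarrow> real^'n^'n) \<Rightarrow> bool" where
  "fundamental_matrix A \<Phi> \<longleftrightarrow> continuous_on UNIV \<Phi> \<and>
    (\<forall>t. set_integrable lborel {min 0 t..max 0 t} (\<lambda>r. A r ** \<Phi> r) \<and>
       \<Phi> t = mat 1 + (if 0 \<le> t then (LINT r:{0..t}|lborel. A r ** \<Phi> r)
                      else - (LINT r:{t..0}|lborel. A r ** \<Phi> r)))"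

definition pullback_absorbing :: "(real \<Rightarrow> real \<Rightarrow> 'a::metric_space \<Rightarrow> 'a) \<Rightarrow> 'a set \<Rightarrow> (real \<Rightarrow> 'a set) \<Rightarrow> bool" where
  "pullback_absorbing S X B \<longleftrightarrow> (\<forall>t. B t \<noteq> {} \<and> bounded (B t) \<and> B t \<subseteq> X) \<and>
     (\<forall>t D. bounded D \<and> D \<subseteq> X \<longrightarrow> (\<exists>T>0. \<forall>s\<ge>T. S t (t - s) ` D \<subseteq> B t))"

definition strongly_pullback_bounded_dissipative ::
  "(real \<Rightarrow> real \<Rightarrow> 'a::metric_space \<Rightarrow> 'a) \<Rightarrow> 'a set \<Rightarrow> real \<Rightarrow> bool" where
  "strongly_pullback_bounded_dissipative S X \<tau> \<longleftrightarrow> (\<exists>B. pullback_absorbing S X B \<and>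
     (\<forall>D. bounded D \<and> D \<subseteq> X \<longrightarrow> (\<exists>T>0. \<forall>t\<le>\<tau>. \<forall>s\<ge>T. S t (t - s) ` D \<subseteq> B \<tau>)))"

text \<open>dist_H(S(t,s)D, C(t)) \<rightarrow> 0 as s \<rightarrow> -\<infinity> (Hausdorff semi-distance, written out).\<close>
definition pullback_attracts :: "(real \<Rightarrow> real \<Rightarrow> 'a::metric_space \<Rightarrow> 'a) \<Rightarrow> 'a set \<Rightarrow> (real \<Rightarrow> 'a set) \<Rightarrow> bool" where
  "pullback_attracts S X C \<longleftrightarrow> (\<forall>t D. bounded D \<and> D \<subseteq> X \<longrightarrow>
     (\<forall>e>0. eventually (\<lambda>s. \<forall>y\<in>S t s ` D. \<exists>a\<in>C t. dist y a < e) at_bot))"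

definition pullback_attractor :: "(real \<Rightarrow> real \<Rightarrow> 'a::metric_space \<Rightarrow> 'a) \<Rightarrow> 'a set \<Rightarrow> (real \<Rightarrow> 'a set) \<Rightarrow> bool" where
  "pullback_attractor S X \<A> \<longleftrightarrow> (\<forall>t. compact (\<A> t) \<and> \<A> t \<subseteq> X) \<and>
     (\<forall>t s. s \<le> t \<longrightarrow> S t s ` \<A> s = \<A> t) \<and>
     pullback_attracts S X \<A> \<and>
     (\<forall>C. (\<forall>t. closed (C t)) \<and> pullback_attracts S X C \<longrightarrow> (\<forall>t. \<A> t \<subseteq> C t))"

end

theory Submission
  imports Defs
begin

text \<open>
  Clamping the state to a box \<open>[0, R]\<^sup>N\<close> turns \<open>f\<close> into a globally Lipschitz field. By (A1) its
  solutions cannot leave the orthant, and by (A2) and Gronwall they obey a bound independent of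
  \<open>R\<close>; so they solve the original equation, and \<open>S_f\<close> is a continuous process on the orthant.

  A solution \<open>x\<close> satisfies \<open>0 \<le> x \<le> y\<close>, where \<open>y' = A y + b\<close> starts from the same point: the
  difference solves a linear equation with quasi-positive matrix and nonnegative forcing.
  Variation of constants and (A3) give, for \<open>s \<le> t \<le> 0\<close>,
  \<open>|x t| \<le> K e^(-\<alpha>(t-s)) |x s| + K \<integral> e^(-\<alpha>(t-q)) |b q| dq\<close>, and cutting the integral into unit
  intervals bounds it uniformly by (A4). Times in \<open>[0, \<tau>]\<close> are handled by Gronwall. Hence one compact
  set absorbs at all times \<open>t \<le> \<tau>\<close>, and the pullback omega-limit of the absorbing sets is the attractor.
\<close>

section \<open>Integrals over intervals and Gronwall's inequality\<close>

text \<open>All coefficients are merely locally integrable in time, so no derivative is ever taken: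
  solutions, \<open>\<Phi>\<close> and the product rule are handled through integral equations, and
  sign arguments look at the last time at which a coordinate is nonnegative. The integral of the
  Lipschitz rate takes the place of time: intervals are cut where it grows by 1/2, both for Gronwall
  and for Picard.

  Null sets are the other obstacle. (A1) allows one for each state and (A2) one in the product
  space, whereas a trajectory needs a null set of times that is good for all states at once;
  continuity of \<open>f t\<close> for almost every \<open>t\<close> supplies it.

  (A2) bounds \<open>f\<close> only from above, so it yields norm bounds only together with
  nonnegativity, and the constant of this bound has to be fixed before the clamping radius is
  chosen. (A3) speaks of times up to 0, hence the absorption time is lengthened by
  \<open>\<tau>\<close> when \<open>\<tau> > 0\<close>. \<open>Sf\<close> is a definite description,
  so existence and uniqueness precede every statement on the process.\<close>

lemma set_integrable_Icc_subset:
  fixes f :: "real \<Rightarrow> 'a::euclidean_space"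
  assumes "set_integrable lborel {a..b} f" "a \<le> c" "d \<le> b"
  shows "set_integrable lborel {c..d} f"
  using assms by (intro set_integrable_subset[OF assms(1)]) auto

lemma set_integral_Icc_split:
  fixes f :: "real \<Rightarrow> 'a::euclidean_space"
  assumes f: "set_integrable lborel {a..c} f" and "a \<le> b" "b \<le> c"
  shows "(LINT r:{a..c}|lborel. f r) = (LINT r:{a..b}|lborel. f r) + (LINT r:{b..c}|lborel. f r)"
proof -
  have "(LINT r:{a..b} \<union> {b..c}|lborel. f r)
      = (LINT r:{a..b}|lborel. f r) + (LINT r:{b..c}|lborel. f r)"
  proof (rule set_integral_Un_AE)
    show "AE x in lborel. \<not> (x \<in> {a..b} \<and> x \<in> {b..c})"
      using AE_lborel_singleton[of b] by eventually_elim auto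
  qed (use assms in \<open>auto intro: set_integrable_Icc_subset[OF f]\<close>)
  moreover have "{a..b} \<union> {b..c} = {a..c}" using assms by auto
  ultimately show ?thesis by simp
qed

lemma continuous_on_set_integral_Icc:
  fixes f :: "real \<Rightarrow> 'a::euclidean_space"
  assumes "set_integrable lborel {a..b} f"
  shows "continuous_on {a..b} (\<lambda>x. LINT r:{a..x}|lborel. f r)"
proof -
  have "continuous_on {a..b} (\<lambda>x. integral {a..x} f)"
    using set_borel_integral_eq_integral(1)[OF assms] by (rule indefinite_integral_continuous_1)
  then show ?thesis
    by (rule continuous_on_cong[THEN iffD1, OF refl, rotated])
      (auto intro!: set_borel_integral_eq_integral(2)[symmetric] set_integrable_Icc_subset[OF assms])
qed

text \<open>Needed for coordinates, for multiplication by a fixed matrix, and for applying a matrix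
  function to a fixed vector.\<close>

lemma
  fixes f :: "'b \<Rightarrow> 'a::{banach, second_countable_topology}"
    and T :: "'a \<Rightarrow> 'c::{banach, second_countable_topology}"
  assumes T: "bounded_linear T" and f: "set_integrable M S f"
  shows set_integrable_bounded_linear: "set_integrable M S (\<lambda>r. T (f r))"
    and set_integral_bounded_linear: "(LINT r:S|M. T (f r)) = T (LINT r:S|M. f r)"
proof -
  have eq: "T (indicator S r *\<^sub>R f r) = indicator S r *\<^sub>R T (f r)" for r
    using T by (simp add: bounded_linear.linear linear_scale)
  show "set_integrable M S (\<lambda>r. T (f r))"
    using integrable_bounded_linear[OF T f[unfolded set_integrable_def]]
    by (simp add: set_integrable_def eq)
  show "(LINT r:S|M. T (f r)) = T (LINT r:S|M. f r)"
    using integral_bounded_linear[OF T f[unfolded set_integrable_def]]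
    by (simp add: set_lebesgue_integral_def eq)
qed

lemma
  fixes f :: "'b \<Rightarrow> real^'n"
  assumes "set_integrable M S f"
  shows set_integrable_component: "set_integrable M S (\<lambda>r. f r $ i)"
    and set_integral_component: "(LINT r:S|M. f r) $ i = (LINT r:S|M. f r $ i)"
  using set_integrable_bounded_linear[OF bounded_linear_vec_nth assms, of i]
    set_integral_bounded_linear[OF bounded_linear_vec_nth assms, of i] by auto

section \<open>Measurability and integrability of products\<close>

lemma set_borel_measurable_bilinear:
  fixes h :: "'d \<Rightarrow> 'a::{banach, second_countable_topology}"
    and u :: "'d \<Rightarrow> 'b::{banach, second_countable_topology}"
    and pr :: "'a \<Rightarrow> 'b \<Rightarrow> 'c::{banach, second_countable_topology}"
  assumes pr: "bounded_bilinear pr"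
    and h: "set_borel_measurable M S h" and u: "set_borel_measurable M S u"
  shows "set_borel_measurable M S (\<lambda>r. pr (h r) (u r))"
proof -
  interpret bounded_bilinear pr by (rule pr)
  have "(\<lambda>r. pr (indicator S r *\<^sub>R h r) (indicator S r *\<^sub>R u r)) \<in> borel_measurable M"
    using h u unfolding set_borel_measurable_def
    by (rule borel_measurable_continuous_Pair) (intro continuous_on continuous_intros)
  also have "(\<lambda>r. pr (indicator S r *\<^sub>R h r) (indicator S r *\<^sub>R u r))
      = (\<lambda>r. indicator S r *\<^sub>R pr (h r) (u r))"
    by (auto simp: fun_eq_iff scaleR_left scaleR_right split: split_indicator)
  finally show ?thesis unfolding set_borel_measurable_def .
qed

lemma set_borel_measurable_continuous_Icc:
  fixes u :: "real \<Rightarrow> 'b::{banach, second_countable_topology}"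
  assumes "continuous_on {a..b} u"
  shows "set_borel_measurable lborel {a..b} u"
  unfolding set_borel_measurable_def
  using borel_measurable_continuous_on_indicator[of "{a..b}" u] assms by simp

lemma set_integrable_imp_measurable:
  "set_integrable M S f \<Longrightarrow> set_borel_measurable M S f"
  unfolding set_integrable_def set_borel_measurable_def by simp

text \<open>A continuous factor is bounded on the compact interval, so the product is dominated by a
  multiple of \<open>h\<close>. A general \<open>pr\<close> covers multiplication of reals, matrix
  times vector and, after flipping, a continuous matrix times an integrable vector.\<close>

lemma set_integrable_bilinear_continuous:
  fixes h :: "real \<Rightarrow> 'a::{banach, second_countable_topology}"
    and u :: "real \<Rightarrow> 'b::{banach, second_countable_topology}"
    and pr :: "'a \<Rightarrow> 'b \<Rightarrow> 'c::{banach, second_countable_topology}"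
  assumes pr: "bounded_bilinear pr"
    and h: "set_integrable lborel {a..b} h" and u: "continuous_on {a..b} u"
  shows "set_integrable lborel {a..b} (\<lambda>r. pr (h r) (u r))"
proof -
  obtain K where K: "0 < K" "\<And>x y. norm (pr x y) \<le> norm x * norm y * K"
    using bounded_bilinear.pos_bounded[OF pr] by blast
  have "bounded (u ` {a..b})"
    using compact_continuous_image[OF u] compact_imp_bounded by blast
  then obtain U where U: "\<And>r. r \<in> {a..b} \<Longrightarrow> norm (u r) \<le> U"
    unfolding bounded_iff by blast
  show ?thesis
  proof (rule set_integrable_bound)
    show "set_integrable lborel {a..b} (\<lambda>r. (U * K) *\<^sub>R h r)"
      using h by simp
    show "set_borel_measurable lborel {a..b} (\<lambda>r. pr (h r) (u r))"
      by (intro set_borel_measurable_bilinear[OF pr] set_integrable_imp_measurable h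
          set_borel_measurable_continuous_Icc u)
    show "AE r in lborel. r \<in> {a..b} \<longrightarrow> norm (pr (h r) (u r)) \<le> norm ((U * K) *\<^sub>R h r)"
    proof (intro AE_I2 impI)
      fix r assume r: "r \<in> {a..b}"
      have "norm (pr (h r) (u r)) \<le> norm (h r) * norm (u r) * K" by (rule K)
      also have "\<dots> \<le> norm (h r) * U * K"
        using U[OF r] K(1) by (intro mult_right_mono mult_left_mono) auto
      also have "\<dots> \<le> \<bar>U * K\<bar> * norm (h r)"
        by (metis abs_ge_self mult.assoc mult.commute mult_right_mono norm_ge_zero)
      finally show "norm (pr (h r) (u r)) \<le> norm ((U * K) *\<^sub>R h r)" by simp
    qed
  qed
qed

lemmas set_integrable_mult_continuous =
  set_integrable_bilinear_continuous[OF bounded_bilinear_mult]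

text \<open>The norm of the matrix type is the Frobenius norm; Cauchy-Schwarz is applied to each
  row. The operator norm enters only with the decay hypothesis.\<close>

lemma norm_matrix_vector_mult_le:
  fixes A :: "real^'n^'m"
  shows "norm (A *v x) \<le> norm A * norm x"
proof -
  have "norm (A *v x) = L2_set (\<lambda>i. \<bar>A $ i \<bullet> x\<bar>) UNIV"
    by (simp add: norm_vec_def matrix_vector_mult_def inner_vec_def)
  also have "\<dots> \<le> L2_set (\<lambda>i. norm (A $ i) * norm x) UNIV"
    by (rule L2_set_mono) (auto simp: Cauchy_Schwarz_ineq2)
  also have "\<dots> = norm A * norm x"
    by (simp add: L2_set_left_distrib norm_vec_def)
  finally show ?thesis .
qed

lemma bounded_bilinear_matrix_vector_mult:
  "bounded_bilinear ((*v) :: real^'n^'m \<Rightarrow> real^'n \<Rightarrow> real^'m)"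
proof
  show "\<exists>K. \<forall>A x. norm ((A :: real^'n^'m) *v x) \<le> norm A * norm x * K"
    by (rule exI[of _ 1]) (simp add: norm_matrix_vector_mult_le)
qed (auto simp: matrix_vector_mult_add_rdistrib matrix_vector_right_distrib
    scaleR_matrix_vector_assoc matrix_vector_mult_scaleR)

lemma set_integral_nonneg_Icc:
  fixes f :: "real \<Rightarrow> real"
  assumes "AE r in lborel. r \<in> {a..b} \<longrightarrow> 0 \<le> f r"
  shows "0 \<le> (LINT r:{a..b}|lborel. f r)"
  unfolding set_lebesgue_integral_def
  using assms by (intro integral_nonneg_AE) (auto elim!: eventually_mono split: split_indicator)

text \<open>The usual exponential of the integral of \<open>l\<close> is replaced by a power of 2:
  while that integral grows by 1/2, the bound at most doubles. \<open>M\<close> is fixed before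
  \<open>u\<close> and \<open>c\<close>, so it is uniform over solutions, and \<open>c = 0\<close>
  forces \<open>u\<close> to vanish.\<close>

lemma gronwall_L1:
  fixes l :: "real \<Rightarrow> real"
  assumes l: "set_integrable lborel {a..b} l" and l0: "\<And>r. r \<in> {a..b} \<Longrightarrow> 0 \<le> l r"
  obtains M where "M \<ge> 1"
    "\<And>u c t. \<lbrakk>continuous_on {a..b} u; \<And>t. t \<in> {a..b} \<Longrightarrow> 0 \<le> u t; 0 \<le> c;
       \<And>t. t \<in> {a..b} \<Longrightarrow> u t \<le> c + (LINT r:{a..t}|lborel. l r * u r); t \<in> {a..b}\<rbrakk>
       \<Longrightarrow> u t \<le> M * c"
proof -
  define L where "L = (\<lambda>t. LINT r:{a..t}|lborel. l r)"
  have contL: "continuous_on {a..b} L"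
    unfolding L_def by (rule continuous_on_set_integral_Icc[OF l])
  have main: "c + (LINT r:{a..t}|lborel. l r * u r) \<le> 2 ^ n * c"
    if u: "continuous_on {a..b} u" and u0: "\<And>t. t \<in> {a..b} \<Longrightarrow> 0 \<le> u t" and c: "0 \<le> c"
      and le: "\<And>t. t \<in> {a..b} \<Longrightarrow> u t \<le> c + (LINT r:{a..t}|lborel. l r * u r)"
      and t: "t \<in> {a..b}" and Ln: "L t \<le> real n / 2"
    for u c t n
  proof -
    \<comment> \<open>\<open>V\<close> dominates \<open>u\<close> and, unlike \<open>u\<close>, is
      monotone, so its value at the right end can be pulled out of an integral.\<close>
    define V where "V = (\<lambda>t. c + (LINT r:{a..t}|lborel. l r * u r))"
    have lu: "set_integrable lborel {a..b} (\<lambda>r. l r * u r)"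
      by (rule set_integrable_mult_continuous[OF l u])
    have Vsplit: "V q = V p + (LINT r:{p..q}|lborel. l r * u r)" if "a \<le> p" "p \<le> q" "q \<le> b" for p q
      unfolding V_def using that
      by (subst set_integral_Icc_split[of a q _ p]) (auto intro: set_integrable_Icc_subset[OF lu])
    have Vmono: "V p \<le> V q" if "a \<le> p" "p \<le> q" "q \<le> b" for p q
      unfolding Vsplit[OF that] using that l0 u0
      by (auto intro!: set_integral_nonneg_Icc)
    have uV: "u r \<le> V r" if "r \<in> {a..b}" for r using le[OF that] by (simp add: V_def)
    have half: "V q \<le> V p + (LINT r:{p..q}|lborel. l r) * V q" if pq: "a \<le> p" "p \<le> q" "q \<le> b" for p q
    proof -
      have "(LINT r:{p..q}|lborel. l r * u r) \<le> (LINT r:{p..q}|lborel. l r * V q)"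
      proof (rule set_integral_mono)
        show "set_integrable lborel {p..q} (\<lambda>r. l r * u r)"
          using that by (intro set_integrable_Icc_subset[OF lu]) auto
        show "set_integrable lborel {p..q} (\<lambda>r. l r * V q)"
          using that by (intro set_integrable_mult_left set_integrable_Icc_subset[OF l]) auto
        show "l r * u r \<le> l r * V q" if "r \<in> {p..q}" for r
          using that pq l0[of r] uV[of r] Vmono[of r q] by (intro mult_left_mono) auto
      qed
      then show ?thesis using Vsplit[OF that] by simp
    qed
    have "V t \<le> 2 ^ n * c" using t Ln
    proof (induction n arbitrary: t)
      case 0
      have "0 \<le> L t" unfolding L_def using 0 l0 by (intro set_integral_nonneg_Icc) auto
      with 0 have "L t = 0" by simp
      then have "V t \<le> V a" using half[of a t] 0 by (simp add: L_def)
      moreover have "V a = c"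
      proof -
        have "(LINT r:{a..a}|lborel. l r * u r) + (LINT r:{a..a}|lborel. l r * u r)
            = (LINT r:{a..a}|lborel. l r * u r)"
          using 0 by (intro set_integral_Icc_split[symmetric] set_integrable_Icc_subset[OF lu]) auto
        then show ?thesis unfolding V_def by simp
      qed
      ultimately show ?case by simp
    next
      case (Suc n)
      show ?case
      proof (cases "L t \<le> real n / 2")
        case True
        then have "V t \<le> 2 ^ n * c" using Suc by auto
        also have "\<dots> \<le> 2 ^ Suc n * c" using c by simp
        finally show ?thesis .
      next
        case False
        have La: "L a \<le> real n / 2"
        proof -
          have "L a + L a = L a" unfolding L_def
            using Suc.prems by (intro set_integral_Icc_split[symmetric] set_integrable_Icc_subset[OF l]) auto
          then show ?thesis by simp
        qed
        \<comment> \<open>The stretch from \<open>p\<close> to \<open>t\<close> carries an integral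
          of \<open>l\<close> of at most 1/2, so \<open>half\<close> bounds \<open>V t\<close> by
          \<open>V p\<close> plus half of \<open>V t\<close>: the bound doubles.\<close>
        obtain p where p: "a \<le> p" "p \<le> t" "L p = real n / 2"
          using IVT'[of L a "real n / 2" t] La False Suc.prems continuous_on_subset[OF contL, of "{a..t}"]
          by auto
        have "V p \<le> 2 ^ n * c" using Suc.IH[of p] p Suc.prems by auto
        moreover have "L t = L p + (LINT r:{p..t}|lborel. l r)"
          unfolding L_def using p Suc.prems
          by (intro set_integral_Icc_split set_integrable_Icc_subset[OF l]) auto
        then have "(LINT r:{p..t}|lborel. l r) \<le> 1 / 2" using p Suc.prems by (simp add: field_simps)
        moreover have "0 \<le> V t" using uV[of t] u0[of t] Suc.prems by linarith
        ultimately have "V t \<le> 2 ^ n * c + 1 / 2 * V t"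
          using half[of p t] p Suc.prems mult_right_mono[of "LINT r:{p..t}|lborel. l r" "1/2" "V t"]
          by auto
        then show ?thesis by simp
      qed
    qed
    then show ?thesis by (simp add: V_def)
  qed
  \<comment> \<open>The number of half units, rounded up, in the total integral of
    \<open>l\<close>.\<close>
  define n where "n = nat \<lceil>2 * L b\<rceil>"
  have Lle: "L t \<le> real n / 2" if "t \<in> {a..b}" for t
  proof -
    have "L b = L t + (LINT r:{t..b}|lborel. l r)"
      unfolding L_def using that by (intro set_integral_Icc_split l) auto
    moreover have "0 \<le> (LINT r:{t..b}|lborel. l r)"
      using that l0 by (intro set_integral_nonneg_Icc) auto
    ultimately have "L t \<le> L b" by simp
    moreover have "2 * L b \<le> real n" unfolding n_def by linarith
    ultimately show ?thesis by simp
  qed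
  show ?thesis
  proof (rule that[of "2 ^ n"])
    fix u :: "real \<Rightarrow> real" and c t
    assume *: "continuous_on {a..b} u" "\<And>t. t \<in> {a..b} \<Longrightarrow> 0 \<le> u t" "0 \<le> c"
       "\<And>t. t \<in> {a..b} \<Longrightarrow> u t \<le> c + (LINT r:{a..t}|lborel. l r * u r)" "t \<in> {a..b}"
    have "c + (LINT r:{a..t}|lborel. l r * u r) \<le> 2 ^ n * c"
      by (rule main[where u=u]) (use * Lle in auto)
    then show "u t \<le> 2 ^ n * c" using *(4)[OF *(5)] by simp
  qed simp
qed

section \<open>Solutions of Caratheodory equations\<close>

lemma set_integral_point [simp]:
  fixes f :: "real \<Rightarrow> 'a::euclidean_space"
  shows "(LINT r:{a}|lborel. f r) = 0"
  unfolding set_lebesgue_integral_def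
proof (rule integral_eq_zero_AE)
  show "AE x in lborel. indicator {a} x *\<^sub>R f x = 0"
    using AE_lborel_singleton[of a] by eventually_elim auto
qed

lemma is_solutionD:
  assumes "is_solution f s x0 t x"
  shows "s \<le> t" "continuous_on {s..t} x"
    "s \<le> u \<Longrightarrow> u \<le> t \<Longrightarrow> set_integrable lborel {s..u} (\<lambda>r. f r (x r))"
    "s \<le> u \<Longrightarrow> u \<le> t \<Longrightarrow> x u = x0 + (LINT r:{s..u}|lborel. f r (x r))"
  using assms by (auto simp only: is_solution_def atLeastAtMost_iff)

lemma is_solution_start: "is_solution f s x0 t x \<Longrightarrow> x s = x0"
  using is_solutionD(1)[of f s x0 t x] is_solutionD(4)[of f s x0 t x s] by simp

lemma is_solution_subinterval:
  assumes x: "is_solution f s x0 t x" and r: "s \<le> r" "r \<le> q" "q \<le> t"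
  shows "is_solution f r (x r) q x"
  unfolding is_solution_def
proof (intro conjI ballI)
  show "continuous_on {r..q} x"
    using x r unfolding is_solution_def by (auto intro: continuous_on_subset)
  fix u assume u: "u \<in> {r..q}"
  have int: "set_integrable lborel {s..u} (\<lambda>r. f r (x r))"
    by (rule is_solutionD[OF x]; use u r in simp)
  show "set_integrable lborel {r..u} (\<lambda>r. f r (x r))"
    using r by (intro set_integrable_Icc_subset[OF int]) auto
  show "x u = x r + (LINT r:{r..u}|lborel. f r (x r))"
  proof -
    have "(LINT q:{s..u}|lborel. f q (x q)) = (LINT q:{s..r}|lborel. f q (x q)) + (LINT q:{r..u}|lborel. f q (x q))"
      using u r by (intro set_integral_Icc_split[OF int]) auto
    moreover have "x u = x0 + (LINT q:{s..u}|lborel. f q (x q))" "x r = x0 + (LINT q:{s..r}|lborel. f q (x q))"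
      by (rule is_solutionD[OF x]; use u r in simp)+
    ultimately show ?thesis by (metis add.assoc)
  qed
qed fact

lemma is_solution_cong:
  assumes "is_solution f s x0 t x" and eq: "\<And>u. u \<in> {s..t} \<Longrightarrow> x u = y u"
  shows "is_solution f s x0 t y"
  unfolding is_solution_def
proof (intro conjI ballI)
  show "s \<le> t" "continuous_on {s..t} y"
    using assms continuous_on_cong[OF refl, of "{s..t}" x y] unfolding is_solution_def by auto
  fix u assume u: "u \<in> {s..t}"
  have "set_integrable lborel {s..u} (\<lambda>r. f r (y r)) = set_integrable lborel {s..u} (\<lambda>r. f r (x r))"
    using u eq by (intro set_integrable_cong) auto
  moreover have "(LINT r:{s..u}|lborel. f r (y r)) = (LINT r:{s..u}|lborel. f r (x r))"
    using u eq by (intro set_lebesgue_integral_cong) auto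
  ultimately show "set_integrable lborel {s..u} (\<lambda>r. f r (y r))"
    "y u = x0 + (LINT r:{s..u}|lborel. f r (y r))"
    using assms u unfolding is_solution_def by auto
qed

lemma is_solution_concat:
  assumes x: "is_solution f s x0 r x" and y: "is_solution f r (x r) t y"
  shows "is_solution f s x0 t (\<lambda>u. if u \<le> r then x u else y u)"
proof -
  define z where "z = (\<lambda>u. if u \<le> r then x u else y u)"
  have st: "s \<le> r" "r \<le> t" using x y by (auto simp: is_solution_def)
  have yr: "y r = x r" by (rule is_solution_start[OF y])
  have zx: "is_solution f s x0 r z" by (rule is_solution_cong[OF x]) (auto simp: z_def)
  have zy: "is_solution f r (z r) t z"
  proof -
    have "is_solution f r (x r) t z" by (rule is_solution_cong[OF y]) (auto simp: z_def yr)
    then show ?thesis by (simp add: z_def)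
  qed
  have un: "{s..t} = {s..r} \<union> {r..t}" using st by auto
  have "is_solution f s x0 t z"
    unfolding is_solution_def
  proof (intro conjI)
    show "s \<le> t" using st by simp
    show "continuous_on {s..t} z"
      unfolding un using zx zy by (intro continuous_on_closed_Un) (auto simp: is_solution_def)
    show "\<forall>u\<in>{s..t}. set_integrable lborel {s..u} (\<lambda>r. f r (z r)) \<and>
        z u = x0 + (LINT r:{s..u}|lborel. f r (z r))"
    proof
      fix u assume u: "u \<in> {s..t}"
      show "set_integrable lborel {s..u} (\<lambda>r. f r (z r)) \<and>
        z u = x0 + (LINT r:{s..u}|lborel. f r (z r))"
      proof (cases "u \<le> r")
        case True
        then show ?thesis using is_solutionD(3,4)[OF zx, of u] u by auto
      next
        case False
        have 1: "set_integrable lborel {s..r} (\<lambda>r. f r (z r))"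
            "z r = x0 + (LINT r:{s..r}|lborel. f r (z r))"
          by (rule is_solutionD[OF zx]; use st in simp)+
        have 2: "set_integrable lborel {r..u} (\<lambda>r. f r (z r))"
            "z u = z r + (LINT r:{r..u}|lborel. f r (z r))"
          by (rule is_solutionD[OF zy]; use u False in simp)+
        have "{s..u} = {s..r} \<union> {r..u}" using st False u by auto
        then have int: "set_integrable lborel {s..u} (\<lambda>r. f r (z r))"
          using set_integrable_Un[OF 1(1) 2(1)] by simp
        have "(LINT r:{s..u}|lborel. f r (z r))
            = (LINT r:{s..r}|lborel. f r (z r)) + (LINT r:{r..u}|lborel. f r (z r))"
          using False st by (intro set_integral_Icc_split[OF int]) auto
        then have "z u = x0 + (LINT r:{s..u}|lborel. f r (z r))"
          using 1(2) 2(2) by (metis add.assoc)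
        with int show ?thesis by simp
      qed
    qed
  qed
  then show ?thesis by (simp add: z_def)
qed

section \<open>Existence by Picard iteration\<close>

lemma caratheodory_measurable:
  fixes g :: "real \<Rightarrow> real^'n \<Rightarrow> real^'n"
  assumes g: "(\<lambda>p. g (fst p) (snd p)) \<in> borel_measurable borel"
    and x: "continuous_on {a..b} x"
  shows "set_borel_measurable lborel {a..b} (\<lambda>r. g r (x r))"
proof -
  \<comment> \<open>\<open>x\<close> is continuous only on the interval, so it is extended by 0 to a
    Borel function on the line; a second indicator, outside \<open>g\<close>, then removes the
    values of \<open>g\<close> at the state 0.\<close>
  let ?x = "\<lambda>r. indicator {a..b} r *\<^sub>R x r"
  have "?x \<in> borel_measurable borel"
    using set_borel_measurable_continuous_Icc[OF x] by (simp add: set_borel_measurable_def)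
  then have "(\<lambda>r. (r, ?x r)) \<in> borel_measurable borel"
    by (intro borel_measurable_Pair) auto
  from measurable_compose[OF this g] have "(\<lambda>r. g r (?x r)) \<in> borel_measurable borel" by simp
  then have "(\<lambda>r. indicator {a..b} r *\<^sub>R g r (?x r)) \<in> borel_measurable borel"
    by (intro borel_measurable_scaleR) auto
  also have "(\<lambda>r. indicator {a..b} r *\<^sub>R g r (?x r)) = (\<lambda>r. indicator {a..b} r *\<^sub>R g r (x r))"
    by (auto split: split_indicator)
  finally show ?thesis by (simp add: set_borel_measurable_def)
qed

lemma caratheodory_integrable:
  fixes g :: "real \<Rightarrow> real^'n \<Rightarrow> real^'n" and m :: "real \<Rightarrow> real"
  assumes g: "(\<lambda>p. g (fst p) (snd p)) \<in> borel_measurable borel"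
    and x: "continuous_on {a..b} x" and m: "set_integrable lborel {a..b} m"
    and bound: "AE r in lborel. r \<in> {a..b} \<longrightarrow> norm (g r (x r)) \<le> m r"
  shows "set_integrable lborel {a..b} (\<lambda>r. g r (x r))"
  by (rule set_integrable_bound[OF m caratheodory_measurable[OF g x]])
    (use bound in \<open>auto elim!: eventually_mono\<close>)

lemma set_integral_norm_le:
  fixes h :: "real \<Rightarrow> 'a::euclidean_space"
  assumes h: "set_integrable lborel S h" and k: "set_integrable lborel S k"
    and le: "AE r in lborel. r \<in> S \<longrightarrow> norm (h r) \<le> k r"
  shows "norm (LINT r:S|lborel. h r) \<le> (LINT r:S|lborel. k r)"
proof -
  have "norm (LINT r:S|lborel. h r) \<le> (LINT r:S|lborel. norm (h r))"
    by (rule set_integral_norm_bound[OF h])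
  also have "\<dots> \<le> (LINT r:S|lborel. k r)"
    by (rule set_integral_mono_AE[OF set_integrable_norm[OF h] k le])
  finally show ?thesis .
qed

text \<open>When the Lipschitz rate has integral at most 1/2, the integral operator contracts by 1/2
  in the plain supremum norm, so no weighted norm is called for.\<close>

lemma picard_short:
  fixes g :: "real \<Rightarrow> real^'n \<Rightarrow> real^'n"
  assumes st: "s \<le> t"
    and g: "(\<lambda>p. g (fst p) (snd p)) \<in> borel_measurable borel"
    and m: "set_integrable lborel {s..t} m" and l: "set_integrable lborel {s..t} l"
    and l0: "\<And>r. 0 \<le> l r"
    and bd: "AE r in lborel. \<forall>x y. norm (g r x) \<le> m r \<and> norm (g r x - g r y) \<le> l r * norm (x - y)"
    and half: "(LINT r:{s..t}|lborel. l r) \<le> 1 / 2"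
  shows "\<exists>x. is_solution g s x0 t x"
proof -
  define F where "F = (\<lambda>\<phi> u. x0 + (LINT r:{s..u}|lborel. g r (\<phi> r)))"
  \<comment> \<open>Retraction of the line onto \<open>{s..t}\<close>: with it the operator maps
    bounded continuous functions on the whole line, which form a complete type, to themselves, and
    Banach's fixed point theorem for types applies.\<close>
  define pj where "pj = (\<lambda>u. max s (min t u))"
  have pj: "pj u \<in> {s..t}" for u using st by (auto simp: pj_def)
  have pj_id: "u \<in> {s..t} \<Longrightarrow> pj u = u" for u by (auto simp: pj_def)
  have contpj: "continuous_on UNIV pj" unfolding pj_def by (intro continuous_intros)
  have int: "set_integrable lborel {s..t} (\<lambda>r. g r (\<phi> r))" if "continuous_on UNIV \<phi>" for \<phi>
    by (rule caratheodory_integrable[OF g _ m])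
      (use that bd in \<open>auto intro: continuous_on_subset elim!: eventually_mono\<close>)
  have contF: "continuous_on {s..t} (F \<phi>)" if "continuous_on UNIV \<phi>" for \<phi>
    unfolding F_def by (intro continuous_intros continuous_on_set_integral_Icc int that)
  define G :: "(real \<Rightarrow>\<^sub>C (real^'n)) \<Rightarrow> (real \<Rightarrow>\<^sub>C (real^'n))"
    where "G = (\<lambda>\<phi>. Bcontfun (\<lambda>u. F (apply_bcontfun \<phi>) (pj u)))"
  have G: "apply_bcontfun (G \<phi>) = (\<lambda>u. F (apply_bcontfun \<phi>) (pj u))" for \<phi>
    unfolding G_def
  proof (rule Bcontfun_inverse)
    have "continuous_on UNIV (\<lambda>u. F (apply_bcontfun \<phi>) (pj u))"
      by (rule continuous_on_compose2[OF contF contpj]) (use pj in auto)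
    moreover have "range (\<lambda>u. F (apply_bcontfun \<phi>) (pj u)) \<subseteq> F (apply_bcontfun \<phi>) ` {s..t}"
      using pj by auto
    moreover have "bounded (F (apply_bcontfun \<phi>) ` {s..t})"
      by (intro compact_imp_bounded compact_continuous_image contF) auto
    ultimately show "(\<lambda>u. F (apply_bcontfun \<phi>) (pj u)) \<in> bcontfun"
      unfolding bcontfun_def using bounded_subset by blast
  qed
  have contr: "dist (G \<phi>) (G \<psi>) \<le> 1 / 2 * dist \<phi> \<psi>" for \<phi> \<psi>
  proof (rule dist_bound)
    fix u
    have i: "set_integrable lborel {s..pj u} (\<lambda>r. g r (\<phi> r))" "set_integrable lborel {s..pj u} (\<lambda>r. g r (\<psi> r))"
      "set_integrable lborel {s..pj u} l"
      using pj[of u] by (auto intro: set_integrable_Icc_subset[OF int] set_integrable_Icc_subset[OF l])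
    have "dist (G \<phi> u) (G \<psi> u) = norm (LINT r:{s..pj u}|lborel. g r (\<phi> r) - g r (\<psi> r))"
      unfolding G F_def using i by (simp add: dist_norm)
    also have "\<dots> \<le> (LINT r:{s..pj u}|lborel. l r * dist \<phi> \<psi>)"
    proof (rule set_integral_norm_le)
      show "AE r in lborel. r \<in> {s..pj u} \<longrightarrow> norm (g r (\<phi> r) - g r (\<psi> r)) \<le> l r * dist \<phi> \<psi>"
        using bd
      proof eventually_elim
        case (elim r)
        have "norm (g r (\<phi> r) - g r (\<psi> r)) \<le> l r * norm (\<phi> r - \<psi> r)" using elim by blast
        also have "\<dots> \<le> l r * dist \<phi> \<psi>"
          using l0 dist_bounded[of \<phi> r \<psi>] by (intro mult_left_mono) (auto simp: dist_norm)
        finally show ?case by simp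
      qed
    qed (use i in auto)
    also have "\<dots> = (LINT r:{s..pj u}|lborel. l r) * dist \<phi> \<psi>" by simp
    also have "\<dots> \<le> 1 / 2 * dist \<phi> \<psi>"
    proof (rule mult_right_mono)
      have "0 \<le> (LINT r:{pj u..t}|lborel. l r)" using l0 by (intro set_integral_nonneg_Icc) auto
      then show "(LINT r:{s..pj u}|lborel. l r) \<le> 1 / 2"
        using half set_integral_Icc_split[OF l, of "pj u"] pj[of u] by auto
    qed simp
    finally show "dist (G \<phi> u) (G \<psi> u) \<le> 1 / 2 * dist \<phi> \<psi>" .
  qed
  obtain \<phi> where \<phi>: "G \<phi> = \<phi>"
    using banach_fix_type[of "1/2" G] contr by auto
  have eq: "\<phi> u = F \<phi> u" if "u \<in> {s..t}" for u
    using G[of \<phi>] pj_id[OF that] unfolding \<phi> by metis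
  have "is_solution g s x0 t \<phi>"
    unfolding is_solution_def
  proof (intro conjI ballI st)
    fix u assume u: "u \<in> {s..t}"
    show "set_integrable lborel {s..u} (\<lambda>r. g r (\<phi> r))"
      using u by (intro set_integrable_Icc_subset[OF int]) auto
    show "\<phi> u = x0 + (LINT r:{s..u}|lborel. g r (\<phi> r))"
      using eq[OF u] by (simp add: F_def)
  qed auto
  then show ?thesis by blast
qed

text \<open>The smallness of the integral is lifted by cutting where the integral \<open>L\<close>
  of the rate has grown by 1/2 and concatenating the pieces, by induction on the number of half
  units.\<close>

lemma picard:
  fixes g :: "real \<Rightarrow> real^'n \<Rightarrow> real^'n"
  assumes st: "s \<le> t"
    and g: "(\<lambda>p. g (fst p) (snd p)) \<in> borel_measurable borel"
    and m: "set_integrable lborel {s..t} m" and l: "set_integrable lborel {s..t} l"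
    and l0: "\<And>r. 0 \<le> l r"
    and bd: "AE r in lborel. \<forall>x y. norm (g r x) \<le> m r \<and> norm (g r x - g r y) \<le> l r * norm (x - y)"
  shows "\<exists>x. is_solution g s x0 t x"
proof -
  define L where "L = (\<lambda>t. LINT r:{s..t}|lborel. l r)"
  have contL: "continuous_on {s..t} L"
    unfolding L_def by (rule continuous_on_set_integral_Icc[OF l])
  have main: "\<exists>x. is_solution g s x0 q x" if "q \<in> {s..t}" "L q \<le> real n / 2" for q n
    using that
  proof (induction n arbitrary: q)
    case 0
    then show ?case
      by (intro picard_short[OF _ g _ _ l0 bd])
        (auto simp: L_def intro: set_integrable_Icc_subset[OF m] set_integrable_Icc_subset[OF l])
  next
    case (Suc n)
    show ?case
    proof (cases "L q \<le> real n / 2")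
      case False
      obtain p where p: "s \<le> p" "p \<le> q" "L p = real n / 2"
        using IVT'[of L s "real n / 2" q] False Suc.prems continuous_on_subset[OF contL, of "{s..q}"]
        by (auto simp: L_def)
      have "L q = L p + (LINT r:{p..q}|lborel. l r)"
        unfolding L_def using p Suc.prems
        by (intro set_integral_Icc_split set_integrable_Icc_subset[OF l]) auto
      then have h: "(LINT r:{p..q}|lborel. l r) \<le> 1 / 2" using p Suc.prems by (simp add: field_simps)
      obtain x where x: "is_solution g s x0 p x" using Suc.IH[of p] p Suc.prems by auto
      obtain y where "is_solution g p (x p) q y"
        using picard_short[OF p(2) g _ _ l0 bd h] p Suc.prems
        by (meson set_integrable_Icc_subset[OF m] set_integrable_Icc_subset[OF l] atLeastAtMost_iff)
      then show ?thesis using is_solution_concat[OF x] by blast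
    qed (use Suc in auto)
  qed
  have "L t \<le> real (nat \<lceil>2 * L t\<rceil>) / 2" by linarith
  then show ?thesis using main[of t] st by auto
qed

section \<open>Uniqueness and dependence on the initial value\<close>

lemma LC_bounds:
  assumes "LC f" "compact K"
  obtains m l :: "real \<Rightarrow> real" where "\<forall>a c. set_integrable lborel {a..c} m"
    "\<forall>a c. set_integrable lborel {a..c} l"
    "AE t in lborel. \<forall>x\<in>K. \<forall>y\<in>K. norm (f t x) \<le> m t \<and> norm (f t x - f t y) \<le> l t * norm (x - y)"
  using assms unfolding LC_def by blast

text \<open>Gronwall for the difference of two solutions. \<open>M\<close> is fixed before the
  solutions: it serves uniqueness, where \<open>K\<close> is built from two given trajectories, and
  continuity of the process, where \<open>K\<close> is a ball.\<close>

lemma LC_stability: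
  fixes f :: "real \<Rightarrow> real^'n \<Rightarrow> real^'n"
  assumes f: "LC f" and K: "compact K" and st: "s \<le> t"
  obtains M where "\<And>x y x0 y0. \<lbrakk>is_solution f s x0 t x; is_solution f s y0 t y;
      x ` {s..t} \<subseteq> K; y ` {s..t} \<subseteq> K\<rbrakk> \<Longrightarrow> norm (x t - y t) \<le> M * norm (x0 - y0)"
proof -
  obtain m l where "\<forall>a c. set_integrable lborel {a..c} m" and l: "\<forall>a c. set_integrable lborel {a..c} l"
    and bd: "AE t in lborel. \<forall>x\<in>K. \<forall>y\<in>K. norm (f t x) \<le> m t \<and> norm (f t x - f t y) \<le> l t * norm (x - y)"
    by (rule LC_bounds[OF f K])
  \<comment> \<open>\<open>l\<close> carries no sign in \<open>LC\<close>, while Gronwall asks for a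
    nonnegative rate.\<close>
  have l': "set_integrable lborel {s..t} (\<lambda>r. \<bar>l r\<bar>)" using l by (intro set_integrable_abs) blast
  obtain M where "M \<ge> 1" and M: "\<And>u c q. \<lbrakk>continuous_on {s..t} u; \<And>t'. t' \<in> {s..t} \<Longrightarrow> 0 \<le> u t'; 0 \<le> c;
       \<And>t'. t' \<in> {s..t} \<Longrightarrow> u t' \<le> c + (LINT r:{s..t'}|lborel. \<bar>l r\<bar> * u r); q \<in> {s..t}\<rbrakk>
       \<Longrightarrow> u q \<le> M * c"
    using gronwall_L1[OF l' abs_ge_zero] by blast
  show ?thesis
  proof (rule that[of M])
    fix x y x0 y0 assume x: "is_solution f s x0 t x" and y: "is_solution f s y0 t y"
      and xK: "x ` {s..t} \<subseteq> K" and yK: "y ` {s..t} \<subseteq> K"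
    have cx: "continuous_on {s..t} x" and cy: "continuous_on {s..t} y"
      using x y by (auto simp: is_solution_def)
    have cu: "continuous_on {s..t} (\<lambda>r. norm (x r - y r))" by (intro continuous_intros cx cy)
    show "norm (x t - y t) \<le> M * norm (x0 - y0)"
    proof (rule M[OF cu])
      fix q assume q: "q \<in> {s..t}"
      have ix: "set_integrable lborel {s..q} (\<lambda>r. f r (x r))" "x q = x0 + (LINT r:{s..q}|lborel. f r (x r))"
        and iy: "set_integrable lborel {s..q} (\<lambda>r. f r (y r))" "y q = y0 + (LINT r:{s..q}|lborel. f r (y r))"
        by ((rule is_solutionD[OF x] | rule is_solutionD[OF y]); use q in simp)+
      have "norm (x q - y q) = norm ((x0 - y0) + (LINT r:{s..q}|lborel. f r (x r) - f r (y r)))"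
        using ix iy by (simp add: algebra_simps)
      also have "\<dots> \<le> norm (x0 - y0) + norm (LINT r:{s..q}|lborel. f r (x r) - f r (y r))"
        by (rule norm_triangle_ineq)
      also have "norm (LINT r:{s..q}|lborel. f r (x r) - f r (y r))
          \<le> (LINT r:{s..q}|lborel. \<bar>l r\<bar> * norm (x r - y r))"
      proof (rule set_integral_norm_le)
        show "set_integrable lborel {s..q} (\<lambda>r. f r (x r) - f r (y r))" using ix iy by simp
        show "set_integrable lborel {s..q} (\<lambda>r. \<bar>l r\<bar> * norm (x r - y r))"
          using q by (intro set_integrable_Icc_subset[OF set_integrable_mult_continuous[OF l' cu]]) auto
        show "AE r in lborel. r \<in> {s..q} \<longrightarrow> norm (f r (x r) - f r (y r)) \<le> \<bar>l r\<bar> * norm (x r - y r)"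
          using bd
        proof eventually_elim
          case (elim r)
          show ?case
          proof
            assume "r \<in> {s..q}"
            then have "x r \<in> K" "y r \<in> K" using xK yK q by auto
            then have "norm (f r (x r) - f r (y r)) \<le> l r * norm (x r - y r)" using elim by blast
            also have "\<dots> \<le> \<bar>l r\<bar> * norm (x r - y r)" by (intro mult_right_mono) auto
            finally show "norm (f r (x r) - f r (y r)) \<le> \<bar>l r\<bar> * norm (x r - y r)" .
          qed
        qed
      qed
      finally show "norm (x q - y q) \<le> norm (x0 - y0) + (LINT r:{s..q}|lborel. \<bar>l r\<bar> * norm (x r - y r))"
        by simp
    qed (use st in auto)
  qed
qed

text \<open>Both trajectories trace out compact sets; on their union the stability estimate with
  equal initial values leaves a difference of zero.\<close>

lemma solution_unique:
  fixes f :: "real \<Rightarrow> real^'n \<Rightarrow> real^'n"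
  assumes f: "LC f" and x: "is_solution f s x0 t x" and y: "is_solution f s x0 t y"
  shows "x t = y t"
proof -
  have "compact (x ` {s..t} \<union> y ` {s..t})"
    using x y by (intro compact_Un compact_continuous_image) (auto simp: is_solution_def)
  moreover have "s \<le> t" using x by (simp add: is_solution_def)
  ultimately obtain M where M: "\<And>x' y' x0 y0. \<lbrakk>is_solution f s x0 t x'; is_solution f s y0 t y';
      x' ` {s..t} \<subseteq> x ` {s..t} \<union> y ` {s..t}; y' ` {s..t} \<subseteq> x ` {s..t} \<union> y ` {s..t}\<rbrakk>
      \<Longrightarrow> norm (x' t - y' t) \<le> M * norm (x0 - y0)"
    using LC_stability[OF f] by blast
  have "norm (x t - y t) \<le> M * norm (x0 - x0)" by (rule M[OF x y]) auto
  then show ?thesis by simp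
qed

lemma Sf_eq:
  assumes "LC f" "is_solution f s x0 t x"
  shows "Sf f t s x0 = x t"
  unfolding Sf_def using assms solution_unique by (intro the_equality) blast+

section \<open>One-sided bounds on the orthant\<close>

text \<open>For \<open>0 \<le> R\<close> this is the nearest-point map onto the cube with side
  \<open>R\<close>. With \<open>max 0\<close> outermost the value lies in the orthant whatever the
  sign of \<open>R\<close>.\<close>

definition box_clamp :: "real \<Rightarrow> real^'n \<Rightarrow> real^'n" where
  "box_clamp R x = (\<chi> i. max 0 (min R (x $ i)))"

lemma box_clamp_nth [simp]: "box_clamp R x $ i = max 0 (min R (x $ i))"
  by (simp add: box_clamp_def)

text \<open>Each coordinate map is 1-Lipschitz; hence the clamped field inherits on the whole space
  the Lipschitz rate of \<open>f\<close> on the cube.\<close>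

lemma norm_box_clamp_diff_le: "norm (box_clamp R x - box_clamp R y) \<le> norm (x - y)"
  by (rule norm_le_componentwise_cart) auto

lemma norm_box_clamp_le: "0 \<le> R \<Longrightarrow> norm (box_clamp R x) \<le> norm x"
  by (rule norm_le_componentwise_cart) auto

lemma nonneg_box_clamp [simp]: "nonneg (box_clamp R x)"
  by (simp add: nonneg_def)

lemma box_clamp_mem_cbox: "0 \<le> R \<Longrightarrow> box_clamp R x \<in> cbox 0 (\<chi> i. R)"
  by (simp add: mem_box_cart)

text \<open>A coordinate is at most the Euclidean norm, so the a priori bound on the norm is enough
  to switch the clamp off.\<close>

lemma box_clamp_id: "nonneg x \<Longrightarrow> norm x \<le> R \<Longrightarrow> box_clamp R x = x"
  unfolding vec_eq_iff
proof
  fix i assume "nonneg x" "norm x \<le> R"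
  then have "0 \<le> x $ i" "x $ i \<le> R"
    using component_le_norm_cart[of x i] by (auto simp: nonneg_def)
  then show "box_clamp R x $ i = x $ i" by simp
qed

lemma continuous_on_box_clamp: "continuous_on S (box_clamp R)"
  unfolding box_clamp_def by (intro continuous_intros)

lemma closed_posorthant: "closed (posorthant :: (real^'n) set)"
proof -
  have "posorthant = (\<Inter>i. {x :: real^'n. 0 \<le> x $ i})" by (auto simp: posorthant_def nonneg_def)
  also have "closed \<dots>" by (intro closed_INT ballI closed_Collect_le continuous_intros)
  finally show ?thesis .
qed

section \<open>One null set of times for all states\<close>

lemma LC_AE_continuous:
  fixes f :: "real \<Rightarrow> real^'n \<Rightarrow> real^'n"
  assumes f: "LC f"
  shows "AE t in lborel. continuous_on UNIV (f t)"
proof -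
  \<comment> \<open>Balls of integer radius exhaust the space, so countably many null sets suffice,
    and each point is interior to one of the balls.\<close>
  have "AE t in lborel. continuous_on (cball 0 (real n)) (f t)" for n
  proof -
    obtain m l where "\<forall>a c. set_integrable lborel {a..c} m" "\<forall>a c. set_integrable lborel {a..c} l"
      and bd: "AE t in lborel. \<forall>x\<in>cball 0 (real n). \<forall>y\<in>cball 0 (real n).
        norm (f t x) \<le> m t \<and> norm (f t x - f t y) \<le> l t * norm (x - y)"
      by (rule LC_bounds[OF f compact_cball])
    from bd show ?thesis
    proof eventually_elim
      case (elim t)
      have "\<bar>l t\<bar>-lipschitz_on (cball 0 (real n)) (f t)"
      proof (rule lipschitz_onI)
        fix x y :: "real^'n" assume xy: "x \<in> cball 0 (real n)" "y \<in> cball 0 (real n)"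
        have "norm (f t x - f t y) \<le> l t * norm (x - y)" using elim xy by blast
        also have "\<dots> \<le> \<bar>l t\<bar> * norm (x - y)" by (intro mult_right_mono) auto
        finally show "dist (f t x) (f t y) \<le> \<bar>l t\<bar> * dist x y" by (simp add: dist_norm)
      qed simp
      then show ?case by (rule lipschitz_on_continuous_on)
    qed
  qed
  then have "AE t in lborel. \<forall>n. continuous_on (cball 0 (real n)) (f t)"
    by (simp add: AE_all_countable)
  then show ?thesis
  proof eventually_elim
    case (elim t)
    show ?case unfolding continuous_on_eq_continuous_at[OF open_UNIV]
    proof
      fix x :: "real^'n"
      obtain n :: nat where "norm x < real n" using reals_Archimedean2 by blast
      then have "x \<in> interior (cball 0 (real n))" by simp
      then show "isCont (f t) x" using elim continuous_on_interior by blast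
    qed
  qed
qed

text \<open>A point of the orthant outside the closed set \<open>C\<close> has a ball missing
  \<open>C\<close>; that ball meets the open orthant in a nonempty open set, which cannot be
  null.\<close>

lemma AE_lborel_imp_everywhere_orthant:
  fixes C :: "(real^'n) set"
  assumes C: "closed C" and ae: "AE x in lborel. nonneg x \<longrightarrow> x \<in> C" and x: "nonneg x"
  shows "x \<in> C"
proof (rule ccontr)
  assume "x \<notin> C"
  then obtain e where e: "e > 0" "\<And>y. dist y x < e \<Longrightarrow> y \<notin> C"
    using C open_Compl[OF C] unfolding open_dist by (metis ComplD ComplI)
  define U where "U = ball x e \<inter> (\<Inter>i. {y :: real^'n. 0 < y $ i})"
  have "open U" unfolding U_def
    by (intro open_Int open_INT) (auto intro!: open_Collect_less continuous_intros)
  moreover have "U \<noteq> {}"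
  proof -
    define v :: "real^'n" where "v = (\<chi> i. 1)"
    \<comment> \<open>Scaled so that the shift along the all-ones vector has length at most
      \<open>e / 2\<close>; the shift moves boundary points of the orthant into its
      interior.\<close>
    define d where "d = e / (2 * (norm v + 1))"
    have d: "d > 0" using e by (simp add: d_def add_nonneg_pos)
    have "norm (d *\<^sub>R v) < e"
    proof -
      have "norm (d *\<^sub>R v) \<le> d * (norm v + 1)" using d by simp
      also have "\<dots> = e / 2" unfolding d_def by (simp add: field_simps add_nonneg_eq_0_iff)
      finally show ?thesis using e by simp
    qed
    then have "x + d *\<^sub>R v \<in> ball x e" by (simp add: dist_norm)
    moreover have "0 < (x + d *\<^sub>R v) $ i" for i
      using x d by (simp add: v_def nonneg_def add_nonneg_pos)
    ultimately show ?thesis unfolding U_def by blast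
  qed
  ultimately have "\<not> negligible U" by (rule open_not_negligible)
  moreover have "negligible U"
  proof -
    obtain N where N: "N \<in> null_sets lborel" "{x. \<not> (nonneg x \<longrightarrow> x \<in> C)} \<subseteq> N"
      using ae unfolding eventually_ae_filter by auto
    have "negligible N" using N(1) null_sets_completionI negligible_iff_null_sets by blast
    moreover have "U \<subseteq> N" using N(2) e(2)
      by (auto simp: U_def nonneg_def dist_commute less_imp_le subset_iff)
    ultimately show ?thesis by (rule negligible_subset)
  qed
  ultimately show False by simp
qed

text \<open>(A1) gives one null set for each state. It is applied to countably many states dense in
  the face \<open>x $ i = 0\<close>, and continuity of \<open>f t\<close> carries the sign to the
  closure.\<close>

lemma LC_A1_AE:
  fixes f :: "real \<Rightarrow> real^'n \<Rightarrow> real^'n"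
  assumes f: "LC f" and A1: "cond_A1 f"
  shows "AE t in lborel. \<forall>x i. nonneg x \<and> x $ i = 0 \<longrightarrow> 0 \<le> f t x $ i"
proof -
  have "AE t in lborel. \<forall>x. nonneg x \<and> x $ i = 0 \<longrightarrow> 0 \<le> f t x $ i" for i
  proof -
    obtain T where T: "countable T" "T \<subseteq> {x :: real^'n. nonneg x \<and> x $ i = 0}"
        "{x. nonneg x \<and> x $ i = 0} \<subseteq> closure T"
      by (rule separable)
    have "AE t in lborel. \<forall>x\<in>T. 0 \<le> f t x $ i"
      unfolding AE_ball_countable[OF T(1)]
      using A1 T(2) unfolding cond_A1_def by blast
    with LC_AE_continuous[OF f] show ?thesis
    proof eventually_elim
      case (elim t)
      have "closed {x. 0 \<le> f t x $ i}"
        by (intro closed_Collect_le continuous_intros elim)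
      then have "closure T \<subseteq> {x. 0 \<le> f t x $ i}"
        using elim by (intro closure_minimal) auto
      then show ?case using T(3) by blast
    qed
  qed
  then have "AE t in lborel. \<forall>i\<in>UNIV. \<forall>x. nonneg x \<and> x $ i = 0 \<longrightarrow> 0 \<le> f t x $ i"
    by (subst AE_finite_all) auto
  then show ?thesis by (auto elim!: eventually_mono)
qed

text \<open>Fubini turns the null set of the product into null slices for almost every
  \<open>t\<close>. When \<open>f t\<close> is continuous, the inequality defines a closed set of
  states, so it extends to the whole orthant.\<close>

lemma LC_A2_AE:
  fixes f :: "real \<Rightarrow> real^'n \<Rightarrow> real^'n"
  assumes f: "LC f"
    and A2: "AE p in lborel \<Otimes>\<^sub>M lborel. nonneg (snd p) \<longrightarrow>
           vle (f (fst p) (snd p)) (A (fst p) *v snd p + b (fst p))"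
  shows "AE t in lborel. \<forall>x. nonneg x \<longrightarrow> vle (f t x) (A t *v x + b t)"
proof -
  have "AE t in lborel. AE x in lborel. nonneg x \<longrightarrow> vle (f t x) (A t *v x + b t)"
    using lborel_pair.AE_pair[OF A2] by simp
  with LC_AE_continuous[OF f] show ?thesis
  proof eventually_elim
    case (elim t)
    have "{x. vle (f t x) (A t *v x + b t)} = (\<Inter>i. {x. f t x $ i \<le> (A t *v x + b t) $ i})"
      by (auto simp: vle_def)
    also have "closed \<dots>"
      using elim(1)
      by (auto intro!: closed_Collect_le continuous_intros
          bounded_linear.continuous_on[OF matrix_vector_mul_bounded_linear])
    finally have "closed {x. vle (f t x) (A t *v x + b t)}" .
    from AE_lborel_imp_everywhere_orthant[OF this] elim(2) show ?case by simp
  qed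
qed

section \<open>Sign and growth of solutions in integral form\<close>

lemma last_nonneg_time:
  fixes v :: "real \<Rightarrow> real"
  assumes v: "continuous_on {s..u} v" and "0 \<le> v s" "s \<le> u"
  obtains p where "s \<le> p" "p \<le> u" "0 \<le> v p" "\<And>q. p < q \<Longrightarrow> q \<le> u \<Longrightarrow> v q < 0"
proof -
  let ?Q = "{s..u} \<inter> v -` {0..}"
  have "closed ?Q" using v by (intro continuous_closed_preimage) auto
  then have "compact ?Q" by (metis compact_Int_closed compact_Icc Int_left_absorb Int_commute inf_assoc)
  moreover have "?Q \<noteq> {}" using assms by auto
  ultimately obtain p where p: "p \<in> ?Q" "\<forall>q\<in>?Q. q \<le> p" using compact_attains_sup by blast
  show ?thesis
  proof (rule that[of p])
    show "v q < 0" if "p < q" "q \<le> u" for q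
    proof (rule ccontr)
      assume "\<not> v q < 0"
      then have "q \<in> ?Q" using p(1) that by auto
      then show False using p(2) that(1) by force
    qed
  qed (use p in auto)
qed

text \<open>This replaces a look at the sign of a derivative: after the last time \<open>p\<close>
  at which \<open>v\<close> is nonnegative, \<open>v\<close> is negative, hence the drift is
  nonnegative and \<open>v u \<ge> v p\<close>.\<close>

lemma nonneg_of_drift:
  fixes v :: "real \<Rightarrow> real"
  assumes v: "continuous_on {s..t} v" and h: "set_integrable lborel {s..t} h" and v0: "0 \<le> v0"
    and eq: "\<And>u. u \<in> {s..t} \<Longrightarrow> v u = v0 + (LINT r:{s..u}|lborel. h r)"
    and ae: "AE r in lborel. r \<in> {s..t} \<longrightarrow> v r < 0 \<longrightarrow> 0 \<le> h r"
    and u: "u \<in> {s..t}"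
  shows "0 \<le> v u"
proof (rule ccontr)
  assume neg: "\<not> 0 \<le> v u"
  have "v s = v0" using eq[of s] u by simp
  then obtain p where p: "s \<le> p" "p \<le> u" "0 \<le> v p" "\<And>q. p < q \<Longrightarrow> q \<le> u \<Longrightarrow> v q < 0"
    using last_nonneg_time[of s u v] continuous_on_subset[OF v, of "{s..u}"] v0 u by auto
  have "v u = v p + (LINT r:{p..u}|lborel. h r)"
    using eq[of u] eq[of p] p u set_integral_Icc_split[of s u h p]
    by (auto intro: set_integrable_Icc_subset[OF h])
  moreover have "0 \<le> (LINT r:{p..u}|lborel. h r)"
  proof (rule set_integral_nonneg_Icc)
    show "AE r in lborel. r \<in> {p..u} \<longrightarrow> 0 \<le> h r"
      \<comment> \<open>\<open>v p\<close> is nonnegative, so nothing is known about the drift at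
        \<open>p\<close> itself; this point is discarded as a null set.\<close>
      using ae AE_lborel_singleton[of p]
    proof eventually_elim
      case (elim r)
      then show ?case using p(4)[of r] p(1) u by auto
    qed
  qed
  ultimately show False using neg p(3) by simp
qed

text \<open>Upper bounds for the components of \<open>h\<close> give a norm bound because
  \<open>x\<close> is nonnegative: the norm is at most the sum of the coordinates. \<open>M\<close>
  is fixed before \<open>h\<close>, so one constant serves \<open>f\<close> and every clamped
  field.\<close>

lemma apriori_bound:
  fixes A :: "real \<Rightarrow> real^'n^'n" and b :: "real \<Rightarrow> real^'n"
  assumes A: "set_integrable lborel {a..c} A" and b: "set_integrable lborel {a..c} b"
  obtains M where "M \<ge> 1"
    "\<And>(x :: real \<Rightarrow> real^'n) x0 h u. \<lbrakk>continuous_on {a..c} x; \<And>u. u \<in> {a..c} \<Longrightarrow> nonneg (x u);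
       set_integrable lborel {a..c} h;
       \<And>u. u \<in> {a..c} \<Longrightarrow> x u = x0 + (LINT r:{a..u}|lborel. h r);
       AE r in lborel. r \<in> {a..c} \<longrightarrow> (\<forall>i. h r $ i \<le> norm (A r) * norm (x r) + norm (b r));
       u \<in> {a..c}\<rbrakk> \<Longrightarrow> norm (x u) \<le> M * (norm x0 + (LINT r:{a..c}|lborel. norm (b r)))"
proof -
  \<comment> \<open>The number of coordinates, which enters when the componentwise bounds are
    summed.\<close>
  define N where "N = real CARD('n)"
  have N: "N \<ge> 1" unfolding N_def using one_le_card_finite[where 'a='n] by simp
  define \<beta> where "\<beta> = (LINT r:{a..c}|lborel. norm (b r))"
  have \<beta>0: "0 \<le> \<beta>" unfolding \<beta>_def by (intro set_integral_nonneg_Icc) auto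
  have nA: "set_integrable lborel {a..c} (\<lambda>r. norm (A r))"
    and nb: "set_integrable lborel {a..c} (\<lambda>r. norm (b r))"
    using A b by (auto intro: set_integrable_norm)
  have NA: "set_integrable lborel {a..c} (\<lambda>r. N * norm (A r))"
    using nA by simp
  obtain M where M1: "M \<ge> 1" and M: "\<And>u d t. \<lbrakk>continuous_on {a..c} u; \<And>t. t \<in> {a..c} \<Longrightarrow> 0 \<le> u t; 0 \<le> d;
       \<And>t. t \<in> {a..c} \<Longrightarrow> u t \<le> d + (LINT r:{a..t}|lborel. N * norm (A r) * u r); t \<in> {a..c}\<rbrakk>
       \<Longrightarrow> u t \<le> M * d"
    using gronwall_L1[OF NA] N by (smt (verit, best) mult_nonneg_nonneg norm_ge_zero)
  show ?thesis
  proof (rule that[of "M * N"])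
    show "1 \<le> M * N" using M1 N by (metis mult_mono mult_1 zero_le_one order_trans)
    fix x :: "real \<Rightarrow> real^'n" and x0 h u
    assume x: "continuous_on {a..c} x" and nn: "\<And>u. u \<in> {a..c} \<Longrightarrow> nonneg (x u)"
      and h: "set_integrable lborel {a..c} h"
      and eq: "\<And>u. u \<in> {a..c} \<Longrightarrow> x u = x0 + (LINT r:{a..u}|lborel. h r)"
      and le: "AE r in lborel. r \<in> {a..c} \<longrightarrow> (\<forall>i. h r $ i \<le> norm (A r) * norm (x r) + norm (b r))"
      and u: "u \<in> {a..c}"
    have cn: "continuous_on {a..c} (\<lambda>r. norm (x r))" by (intro continuous_intros x)
    have Ax: "set_integrable lborel {a..c} (\<lambda>r. norm (A r) * norm (x r))"
      by (rule set_integrable_mult_continuous[OF nA cn])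
    have "norm (x u) \<le> M * (N * (norm x0 + \<beta>))"
    proof (rule M[OF cn _ _ _ u])
      show "0 \<le> N * (norm x0 + \<beta>)" using N \<beta>0 by simp
      fix t assume t: "t \<in> {a..c}"
      have ht: "set_integrable lborel {a..t} h" and
        Axt: "set_integrable lborel {a..t} (\<lambda>r. norm (A r) * norm (x r))" and
        bt: "set_integrable lborel {a..t} (\<lambda>r. norm (b r))"
        using t by (auto intro: set_integrable_Icc_subset[OF h] set_integrable_Icc_subset[OF Ax]
            set_integrable_Icc_subset[OF nb])
      have comp: "x t $ i \<le> norm x0 + \<beta> + (LINT r:{a..t}|lborel. norm (A r) * norm (x r))" for i
      proof -
        have "x t $ i = x0 $ i + (LINT r:{a..t}|lborel. h r $ i)"
          unfolding eq[OF t] by (simp add: set_integral_component[OF ht])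
        also have "(LINT r:{a..t}|lborel. h r $ i) \<le> (LINT r:{a..t}|lborel. norm (A r) * norm (x r) + norm (b r))"
          by (rule set_integral_mono_AE[OF set_integrable_component[OF ht]])
            (use Axt bt le t in \<open>auto elim!: eventually_mono\<close>)
        also have "\<dots> = (LINT r:{a..t}|lborel. norm (A r) * norm (x r)) + (LINT r:{a..t}|lborel. norm (b r))"
          using Axt bt by simp
        also have "(LINT r:{a..t}|lborel. norm (b r)) \<le> \<beta>"
        proof -
          have "0 \<le> (LINT r:{t..c}|lborel. norm (b r))" by (intro set_integral_nonneg_Icc) auto
          then show ?thesis unfolding \<beta>_def using set_integral_Icc_split[OF nb, of t] t by simp
        qed
        also have "x0 $ i \<le> norm x0" using component_le_norm_cart[of x0 i] by simp
        finally show ?thesis by simp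
      qed
      have "norm (x t) \<le> (\<Sum>i\<in>UNIV. \<bar>x t $ i\<bar>)" by (rule norm_le_l1_cart)
      also have "\<dots> = (\<Sum>i\<in>UNIV. x t $ i)" using nn[OF t] by (simp add: nonneg_def)
      also have "\<dots> \<le> (\<Sum>i\<in>(UNIV::'n set). norm x0 + \<beta> + (LINT r:{a..t}|lborel. norm (A r) * norm (x r)))"
        by (rule sum_mono) (rule comp)
      also have "\<dots> = N * (norm x0 + \<beta>) + (LINT r:{a..t}|lborel. N * norm (A r) * norm (x r))"
        by (simp add: N_def algebra_simps)
      finally show "norm (x t) \<le> N * (norm x0 + \<beta>) + (LINT r:{a..t}|lborel. N * norm (A r) * norm (x r))" .
    qed auto
    then show "norm (x u) \<le> M * N * (norm x0 + (LINT r:{a..c}|lborel. norm (b r)))"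
      by (simp add: \<beta>_def)
  qed
qed

section \<open>The process on the orthant\<close>

locale sublinear_LC =
  fixes f :: "real \<Rightarrow> real^'n \<Rightarrow> real^'n"
    and A :: "real \<Rightarrow> real^'n^'n" and b :: "real \<Rightarrow> real^'n"
  assumes LC: "LC f" and A1: "cond_A1 f"
    and A_int: "\<And>a c. set_integrable lborel {a..c} A"
    and b_int: "\<And>a c. set_integrable lborel {a..c} b"
    and A2: "AE p in lborel \<Otimes>\<^sub>M lborel. nonneg (snd p) \<longrightarrow>
           vle (f (fst p) (snd p)) (A (fst p) *v snd p + b (fst p))"
begin

lemma AE_upper: "AE t in lborel. \<forall>x. nonneg x \<longrightarrow> vle (f t x) (A t *v x + b t)"
  by (rule LC_A2_AE[OF LC A2])

lemma AE_component_upper: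
  "AE t in lborel. \<forall>x i. nonneg x \<longrightarrow> f t x $ i \<le> norm (A t) * norm x + norm (b t)"
  using AE_upper
proof eventually_elim
  case (elim t)
  show ?case
  proof (intro allI impI)
    fix x :: "real^'n" and i assume "nonneg x"
    then have "f t x $ i \<le> (A t *v x) $ i + b t $ i" using elim by (simp add: vle_def)
    also have "(A t *v x) $ i \<le> norm (A t) * norm x"
      using component_le_norm_cart[of "A t *v x" i] norm_matrix_vector_mult_le[of "A t" x] by linarith
    also have "b t $ i \<le> norm (b t)" using component_le_norm_cart[of "b t" i] by simp
    finally show "f t x $ i \<le> norm (A t) * norm x + norm (b t)" by simp
  qed
qed

lemma nonneg_solution_bound:
  obtains M where "M \<ge> 1"
    "\<And>x x0 u. \<lbrakk>is_solution f a x0 c x; \<And>u. u \<in> {a..c} \<Longrightarrow> nonneg (x u); u \<in> {a..c}\<rbrakk>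
      \<Longrightarrow> norm (x u) \<le> M * (norm x0 + (LINT r:{a..c}|lborel. norm (b r)))"
proof -
  obtain M where M1: "M \<ge> 1" and M: "\<And>(x :: real \<Rightarrow> real^'n) x0 h u. \<lbrakk>continuous_on {a..c} x; \<And>u. u \<in> {a..c} \<Longrightarrow> nonneg (x u);
       set_integrable lborel {a..c} h;
       \<And>u. u \<in> {a..c} \<Longrightarrow> x u = x0 + (LINT r:{a..u}|lborel. h r);
       AE r in lborel. r \<in> {a..c} \<longrightarrow> (\<forall>i. h r $ i \<le> norm (A r) * norm (x r) + norm (b r));
       u \<in> {a..c}\<rbrakk> \<Longrightarrow> norm (x u) \<le> M * (norm x0 + (LINT r:{a..c}|lborel. norm (b r)))"
    using apriori_bound[OF A_int[of a c] b_int[of a c]] by blast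
  show ?thesis
  proof (rule that[OF M1])
    fix x x0 u assume x: "is_solution f a x0 c x" and nn: "\<And>u. u \<in> {a..c} \<Longrightarrow> nonneg (x u)"
      and u: "u \<in> {a..c}"
    show "norm (x u) \<le> M * (norm x0 + (LINT r:{a..c}|lborel. norm (b r)))"
    proof (rule M[where h = "\<lambda>r. f r (x r)"])
      show "AE r in lborel. r \<in> {a..c} \<longrightarrow> (\<forall>i. f r (x r) $ i \<le> norm (A r) * norm (x r) + norm (b r))"
        using AE_component_upper nn by (auto elim!: eventually_mono)
      show "x u = x0 + (LINT r:{a..u}|lborel. f r (x r))" if "u \<in> {a..c}" for u
        by (rule is_solutionD[OF x]; use that in simp)
      show "set_integrable lborel {a..c} (\<lambda>r. f r (x r))"
        using is_solutionD(1,3)[OF x] by simp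
    qed (use nn u is_solutionD(2)[OF x] in simp_all)
  qed
qed

text \<open>The clamp sends negative coordinates to \<open>0\<close>, so (A1) pushes solutions inward even at points
  outside the orthant.\<close>

lemma exists_nonneg_solution:
  assumes st: "s \<le> t" and x0: "nonneg x0"
  obtains x where "is_solution f s x0 t x" "\<forall>u\<in>{s..t}. nonneg (x u)"
proof -
  obtain M where M1: "M \<ge> 1" and M: "\<And>(x :: real \<Rightarrow> real^'n) x0 h u. \<lbrakk>continuous_on {s..t} x; \<And>u. u \<in> {s..t} \<Longrightarrow> nonneg (x u);
       set_integrable lborel {s..t} h;
       \<And>u. u \<in> {s..t} \<Longrightarrow> x u = x0 + (LINT r:{s..u}|lborel. h r);
       AE r in lborel. r \<in> {s..t} \<longrightarrow> (\<forall>i. h r $ i \<le> norm (A r) * norm (x r) + norm (b r));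
       u \<in> {s..t}\<rbrakk> \<Longrightarrow> norm (x u) \<le> M * (norm x0 + (LINT r:{s..t}|lborel. norm (b r)))"
    using apriori_bound[OF A_int[of s t] b_int[of s t]] by blast
  \<comment> \<open>\<open>M\<close> comes from \<open>A\<close> and \<open>b\<close> before any
    field is fixed, so the radius can be the very bound that solutions of the clamped equation will
    satisfy. This avoids circularity.\<close>
  define R where "R = M * (norm x0 + (LINT r:{s..t}|lborel. norm (b r)))"
  have R: "0 \<le> R" unfolding R_def using M1 by (simp add: set_integral_nonneg_Icc)
  define g where "g = (\<lambda>r x. f r (box_clamp R x))"
  obtain m l where ml: "\<forall>a c. set_integrable lborel {a..c} m" "\<forall>a c. set_integrable lborel {a..c} l"
    and bd: "AE r in lborel. \<forall>x\<in>cbox 0 (\<chi> i. R). \<forall>y\<in>cbox 0 (\<chi> i. R).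
        norm (f r x) \<le> m r \<and> norm (f r x - f r y) \<le> l r * norm (x - y)"
    by (rule LC_bounds[OF LC compact_cbox])
  have fm: "(\<lambda>p. f (fst p) (snd p)) \<in> borel_measurable borel" using LC by (simp add: LC_def)
  have "(\<lambda>p :: real \<times> (real^'n). (fst p, box_clamp R (snd p))) \<in> borel_measurable borel"
    by (intro borel_measurable_continuous_onI continuous_intros
        continuous_on_compose2[OF continuous_on_box_clamp]) auto
  from measurable_compose[OF this fm]
  have gm: "(\<lambda>p. g (fst p) (snd p)) \<in> borel_measurable borel" by (simp add: g_def)
  have "AE r in lborel. \<forall>x y. norm (g r x) \<le> m r \<and> norm (g r x - g r y) \<le> \<bar>l r\<bar> * norm (x - y)"
    using bd
  proof eventually_elim
    case (elim r)
    show ?case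
    proof (intro allI conjI)
      fix x y :: "real^'n"
      have mem: "box_clamp R x \<in> cbox 0 (\<chi> i. R)" "box_clamp R y \<in> cbox 0 (\<chi> i. R)"
        using R by (auto intro: box_clamp_mem_cbox)
      then show "norm (g r x) \<le> m r" using elim by (auto simp: g_def)
      have "norm (g r x - g r y) \<le> l r * norm (box_clamp R x - box_clamp R y)"
        using elim mem by (auto simp: g_def)
      also have "\<dots> \<le> \<bar>l r\<bar> * norm (x - y)"
        by (intro mult_mono norm_box_clamp_diff_le) auto
      finally show "norm (g r x - g r y) \<le> \<bar>l r\<bar> * norm (x - y)" .
    qed
  qed
  moreover have "set_integrable lborel {s..t} (\<lambda>r. \<bar>l r\<bar>)" "set_integrable lborel {s..t} m"
    using ml by (auto intro: set_integrable_abs)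
  ultimately obtain x where x: "is_solution g s x0 t x"
    using picard[OF st gm, of m "\<lambda>r. \<bar>l r\<bar>" x0] by auto
  note cont = is_solutionD(2)[OF x]
  have int: "set_integrable lborel {s..t} (\<lambda>r. g r (x r))"
    using is_solutionD(3)[OF x] st by simp
  have eq: "x u = x0 + (LINT r:{s..u}|lborel. g r (x r))" if "u \<in> {s..t}" for u
    by (rule is_solutionD[OF x]; use that in simp)
  have nn: "nonneg (x u)" if u: "u \<in> {s..t}" for u
    unfolding nonneg_def
  proof
    fix i
    show "0 \<le> x u $ i"
    proof (rule nonneg_of_drift[OF _ set_integrable_component[OF int, of i] _ _ _ u])
      show "continuous_on {s..t} (\<lambda>u. x u $ i)" by (intro continuous_intros cont)
      show "0 \<le> x0 $ i" using x0 by (simp add: nonneg_def)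
      show "x u $ i = x0 $ i + (LINT r:{s..u}|lborel. g r (x r) $ i)" if "u \<in> {s..t}" for u
      proof -
        have "set_integrable lborel {s..u} (\<lambda>r. g r (x r))"
          using that by (intro set_integrable_Icc_subset[OF int]) auto
        from set_integral_component[OF this, of i] show ?thesis
          unfolding eq[OF that] by simp
      qed
      show "AE r in lborel. r \<in> {s..t} \<longrightarrow> x r $ i < 0 \<longrightarrow> 0 \<le> g r (x r) $ i"
        using LC_A1_AE[OF LC A1]
      proof eventually_elim
        case (elim r)
        have "box_clamp R (x r) $ i = 0" if "x r $ i < 0" using that R by simp
        then show ?case using elim nonneg_box_clamp[of R "x r"] unfolding g_def by blast
      qed
    qed
  qed
  \<comment> \<open>Clamping shrinks norms, so \<open>g\<close> obeys the same component bound as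
    \<open>f\<close> and the a priori constant applies to its solutions.\<close>
  have le: "norm (x u) \<le> R" if "u \<in> {s..t}" for u
    unfolding R_def
  proof (rule M[OF cont nn int eq _ that])
    show "AE r in lborel. r \<in> {s..t} \<longrightarrow> (\<forall>i. g r (x r) $ i \<le> norm (A r) * norm (x r) + norm (b r))"
      using AE_component_upper
    proof eventually_elim
      case (elim r)
      show ?case
      proof (intro impI allI)
        fix i
        have "g r (x r) $ i \<le> norm (A r) * norm (box_clamp R (x r)) + norm (b r)"
          using elim by (simp add: g_def)
        also have "\<dots> \<le> norm (A r) * norm (x r) + norm (b r)"
          by (intro add_right_mono mult_left_mono norm_box_clamp_le R) auto
        finally show "g r (x r) $ i \<le> norm (A r) * norm (x r) + norm (b r)" .
      qed
    qed
  qed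
  have gf: "g r (x r) = f r (x r)" if "r \<in> {s..t}" for r
    using box_clamp_id[OF nn[OF that] le[OF that]] by (simp add: g_def)
  have "is_solution f s x0 t x"
    unfolding is_solution_def
  proof (intro conjI ballI st cont)
    fix u assume u: "u \<in> {s..t}"
    have "set_integrable lborel {s..u} (\<lambda>r. f r (x r)) = set_integrable lborel {s..u} (\<lambda>r. g r (x r))"
      using u gf by (intro set_integrable_cong) auto
    then show "set_integrable lborel {s..u} (\<lambda>r. f r (x r))"
      using u is_solutionD(3)[OF x, of u] by simp
    have "(LINT r:{s..u}|lborel. f r (x r)) = (LINT r:{s..u}|lborel. g r (x r))"
      using u gf by (intro set_lebesgue_integral_cong) auto
    then show "x u = x0 + (LINT r:{s..u}|lborel. f r (x r))"
      using eq[OF u] by metis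
  qed
  then show ?thesis using nn by (intro that) auto
qed

text \<open>Restricting one solution to \<open>{s..u}\<close> identifies \<open>Sf f u s x0\<close>
  with its value at \<open>u\<close>; so the curve traced by \<open>Sf\<close> is itself a
  solution.\<close>

lemma
  assumes st: "s \<le> t" and x0: "nonneg x0"
  shows Sf_solution: "is_solution f s x0 t (\<lambda>u. Sf f u s x0)"
    and Sf_nonneg: "nonneg (Sf f t s x0)"
proof -
  obtain x where x: "is_solution f s x0 t x" "\<forall>u\<in>{s..t}. nonneg (x u)"
    by (rule exists_nonneg_solution[OF st x0])
  have eq: "x u = Sf f u s x0" if "u \<in> {s..t}" for u
  proof -
    have "is_solution f s x0 u x"
      using is_solution_subinterval[OF x(1), of s u] is_solution_start[OF x(1)] that by simp
    then show ?thesis using Sf_eq[OF LC] by metis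
  qed
  show "is_solution f s x0 t (\<lambda>u. Sf f u s x0)"
    by (rule is_solution_cong[OF x(1)]) (rule eq)
  show "nonneg (Sf f t s x0)" using x(2) eq[of t] st by (metis atLeastAtMost_iff order_refl)
qed

lemma Sf_cocycle:
  assumes "s \<le> r" "r \<le> t" "nonneg x0"
  shows "Sf f t s x0 = Sf f t r (Sf f r s x0)"
proof -
  have "is_solution f r (Sf f r s x0) t (\<lambda>u. Sf f u s x0)"
    using is_solution_subinterval[OF Sf_solution[of s t x0], of r t] assms by auto
  from Sf_eq[OF LC this] show ?thesis by simp
qed

lemma Sf_bound:
  obtains M where "M \<ge> 1"
    "\<And>x0 u. \<lbrakk>nonneg x0; u \<in> {a..c}\<rbrakk>
      \<Longrightarrow> norm (Sf f u a x0) \<le> M * (norm x0 + (LINT r:{a..c}|lborel. norm (b r)))"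
proof -
  obtain M where M1: "M \<ge> 1" and M:
    "\<And>x x0 u. \<lbrakk>is_solution f a x0 c x; \<And>u. u \<in> {a..c} \<Longrightarrow> nonneg (x u); u \<in> {a..c}\<rbrakk>
      \<Longrightarrow> norm (x u) \<le> M * (norm x0 + (LINT r:{a..c}|lborel. norm (b r)))"
    using nonneg_solution_bound[of a c] by blast
  show ?thesis
  proof (rule that[OF M1])
    fix x0 :: "real^'n" and u assume "nonneg x0" "u \<in> {a..c}"
    then show "norm (Sf f u a x0) \<le> M * (norm x0 + (LINT r:{a..c}|lborel. norm (b r)))"
      by (intro M[OF Sf_solution]) (auto intro: Sf_nonneg)
  qed
qed

text \<open>By the growth bound, all solutions starting in the orthant within distance 1 of
  \<open>x0\<close> stay in one ball, where a single constant \<open>N\<close> compares them. The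
  \<open>+ 1\<close> in \<open>R\<close> makes room for these starting points.\<close>

lemma continuous_on_Sf:
  assumes st: "s \<le> t"
  shows "continuous_on posorthant (Sf f t s)"
  unfolding continuous_on_eq_continuous_within
proof
  fix x0 assume "x0 \<in> (posorthant :: (real^'n) set)"
  then have x0: "nonneg x0" by (simp add: posorthant_def)
  obtain M where M1: "M \<ge> 1" and M: "\<And>x0 u. \<lbrakk>nonneg x0; u \<in> {s..t}\<rbrakk>
      \<Longrightarrow> norm (Sf f u s x0) \<le> M * (norm x0 + (LINT r:{s..t}|lborel. norm (b r)))"
    using Sf_bound[of s t] by blast
  define R where "R = M * (norm x0 + 1 + (LINT r:{s..t}|lborel. norm (b r)))"
  obtain N where N: "\<And>x y x0 y0. \<lbrakk>is_solution f s x0 t x; is_solution f s y0 t y;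
      x ` {s..t} \<subseteq> cball 0 R; y ` {s..t} \<subseteq> cball 0 R\<rbrakk> \<Longrightarrow> norm (x t - y t) \<le> N * norm (x0 - y0)"
    using LC_stability[OF LC compact_cball st] by blast
  have inR: "(\<lambda>u. Sf f u s y) ` {s..t} \<subseteq> cball 0 R" if "nonneg y" "norm y \<le> norm x0 + 1" for y
  proof safe
    fix u assume "u \<in> {s..t}"
    then have "norm (Sf f u s y) \<le> M * (norm y + (LINT r:{s..t}|lborel. norm (b r)))"
      by (rule M[OF that(1)])
    also have "\<dots> \<le> R" unfolding R_def using that M1 by (intro mult_left_mono) auto
    finally show "Sf f u s y \<in> cball 0 R" by simp
  qed
  have lip: "norm (Sf f t s y - Sf f t s x0) \<le> N * norm (y - x0)"
    if "nonneg y" "norm y \<le> norm x0 + 1" for y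
    by (rule N[OF Sf_solution[OF st that(1)] Sf_solution[OF st x0] inR[OF that] inR[OF x0]]) simp
  show "continuous (at x0 within posorthant) (Sf f t s)"
    unfolding continuous_within
  proof (rule tendsto_dist_iff[THEN iffD2], rule Lim_null_comparison)
    have "eventually (\<lambda>y. y \<in> ball x0 1) (at x0 within posorthant)"
      unfolding eventually_at_topological by (intro exI[of _ "ball x0 1"]) auto
    moreover have "eventually (\<lambda>y. y \<in> posorthant) (at x0 within posorthant)"
      by (simp add: eventually_at_filter)
    ultimately show "eventually (\<lambda>y. norm (dist (Sf f t s y) (Sf f t s x0)) \<le> N * norm (y - x0))
        (at x0 within posorthant)"
    proof eventually_elim
      case (elim y)
      have "norm y \<le> norm x0 + 1"
        using elim(1) norm_triangle_ineq2[of y x0] by (simp add: dist_norm norm_minus_commute)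
      then show ?case using lip elim(2) by (simp add: dist_norm posorthant_def)
    qed
    have "((\<lambda>y. N * norm (y - x0)) \<longlongrightarrow> N * norm (x0 - x0)) (at x0 within posorthant)"
      by (intro tendsto_intros)
    then show "((\<lambda>y. N * norm (y - x0)) \<longlongrightarrow> 0) (at x0 within posorthant)" by simp
  qed
qed

end

section \<open>Linear equations\<close>

lemma set_integrable_continuous_bilinear:
  fixes h :: "real \<Rightarrow> 'a::{banach, second_countable_topology}"
    and u :: "real \<Rightarrow> 'b::{banach, second_countable_topology}"
    and pr :: "'b \<Rightarrow> 'a \<Rightarrow> 'c::{banach, second_countable_topology}"
  assumes pr: "bounded_bilinear pr"
    and u: "continuous_on {a..b} u" and h: "set_integrable lborel {a..b} h"
  shows "set_integrable lborel {a..b} (\<lambda>r. pr (u r) (h r))"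
  by (rule set_integrable_bilinear_continuous[OF bounded_bilinear.flip[OF pr] h u])

text \<open>Fubini for \<open>pr (p x) (q y)\<close> over a square: the total is the product of the
  increments of \<open>P\<close> and \<open>Q\<close>, and the two triangles cut out by the diagonal
  give the two terms of the product rule.\<close>

lemma integral_product_rule:
  fixes pr :: "'a::euclidean_space \<Rightarrow> 'b::euclidean_space \<Rightarrow> 'c::euclidean_space" and s t :: real
  assumes pr: "bounded_bilinear pr" and st: "s \<le> t"
    and p: "set_integrable lborel {s..t} p" and q: "set_integrable lborel {s..t} q"
    and P: "\<And>u. u \<in> {s..t} \<Longrightarrow> P u = P0 + (LINT r:{s..u}|lborel. p r)"
    and Q: "\<And>u. u \<in> {s..t} \<Longrightarrow> Q u = Q0 + (LINT r:{s..u}|lborel. q r)"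
  shows "pr (P t) (Q t) = pr P0 Q0 + (LINT r:{s..t}|lborel. pr (p r) (Q r) + pr (P r) (q r))"
proof -
  interpret bounded_bilinear pr by (rule pr)
  obtain K where K: "0 < K" "\<And>x y. norm (pr x y) \<le> norm x * norm y * K"
    using pos_bounded by blast
  define p' where "p' = (\<lambda>x. indicator {s..t} x *\<^sub>R p x)"
  define q' where "q' = (\<lambda>x. indicator {s..t} x *\<^sub>R q x)"
  have p': "integrable lborel p'" and q': "integrable lborel q'"
    using p q by (simp_all add: p'_def q'_def set_integrable_def)
  have p'm[measurable]: "p' \<in> borel_measurable lborel" and q'm[measurable]: "q' \<in> borel_measurable lborel"
    by (rule borel_measurable_integrable, fact p', rule borel_measurable_integrable, fact q')
  define F where "F = (\<lambda>x y. pr (p' x) (q' y))"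
  have Fm: "case_prod F \<in> borel_measurable (lborel \<Otimes>\<^sub>M lborel)"
  proof -
    have "(\<lambda>z. pr (p' (fst z)) (q' (snd z))) \<in> borel_measurable (lborel \<Otimes>\<^sub>M lborel)"
    proof (rule borel_measurable_continuous_Pair[where H = pr])
      show "(\<lambda>z. p' (fst z)) \<in> borel_measurable (lborel \<Otimes>\<^sub>M lborel)"
        by (rule measurable_compose[OF measurable_fst p'm])
      show "(\<lambda>z. q' (snd z)) \<in> borel_measurable (lborel \<Otimes>\<^sub>M lborel)"
        by (rule measurable_compose[OF measurable_snd q'm])
      show "continuous_on UNIV (\<lambda>x. pr (fst x) (snd x))" by (intro continuous_on continuous_intros)
    qed
    then show ?thesis by (simp add: F_def case_prod_beta')
  qed
  have intF: "integrable (lborel \<Otimes>\<^sub>M lborel) (case_prod F)"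
  proof (rule Bochner_Integration.integrable_bound[OF _ Fm])
    show "integrable (lborel \<Otimes>\<^sub>M lborel) (\<lambda>z. norm (p' (fst z)) * norm (q' (snd z)) * K)"
    proof (rule lborel_pair.Fubini_integrable)
      show "(\<lambda>z. norm (p' (fst z)) * norm (q' (snd z)) * K) \<in> borel_measurable (lborel \<Otimes>\<^sub>M lborel)"
        by measurable
    qed (use p' q' in \<open>auto simp: norm_mult abs_mult\<close>)
    show "AE z in lborel \<Otimes>\<^sub>M lborel. norm (case_prod F z) \<le> norm (norm (p' (fst z)) * norm (q' (snd z)) * K)"
      using K by (intro AE_I2) (auto simp: F_def case_prod_beta abs_mult)
  qed
  \<comment> \<open>\<open>G\<close> lives on the closed triangle below the diagonal,
    \<open>H\<close> on the open one above. The inner integrals are increments of \<open>Q\<close>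
    and, once the order is exchanged, of \<open>P\<close>.\<close>
  define G where "G = (\<lambda>x y. indicator {z. snd z \<le> fst z} (x, y) *\<^sub>R F x y)"
  define H where "H = (\<lambda>x y. indicator {z. fst z < snd z} (x, y) *\<^sub>R F x y)"
  have sets_pair: "sets (lborel \<Otimes>\<^sub>M lborel) = sets (borel :: (real \<times> real) measure)"
    by (metis borel_prod sets_lborel sets_pair_measure_cong)
  have intG: "integrable (lborel \<Otimes>\<^sub>M lborel) (case_prod G)"
  proof -
    have "{z. snd z \<le> (fst z :: real)} \<in> sets (lborel \<Otimes>\<^sub>M lborel)"
      unfolding sets_pair by (intro borel_closed closed_Collect_le continuous_intros)
    from integrable_mult_indicator[OF this intF] show ?thesis by (simp add: G_def case_prod_beta')
  qed
  have intH: "integrable (lborel \<Otimes>\<^sub>M lborel) (case_prod H)"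
  proof -
    have "{z. (fst z :: real) < snd z} \<in> sets (lborel \<Otimes>\<^sub>M lborel)"
      unfolding sets_pair by (intro borel_open open_Collect_less continuous_intros)
    from integrable_mult_indicator[OF this intF] show ?thesis by (simp add: H_def case_prod_beta')
  qed
  have PQt: "(\<integral>x. p' x \<partial>lborel) = P t - P0" "(\<integral>x. q' x \<partial>lborel) = Q t - Q0"
    using P[of t] Q[of t] st by (simp_all add: p'_def q'_def set_lebesgue_integral_def)
  have total: "(\<integral>x. (\<integral>y. F x y \<partial>lborel) \<partial>lborel) = pr (P t - P0) (Q t - Q0)"
  proof -
    have "(\<integral>y. F x y \<partial>lborel) = pr (p' x) (Q t - Q0)" for x
      unfolding F_def using integral_bounded_linear[OF bounded_linear_right q'] by (simp add: PQt)
    then show ?thesis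
      using integral_bounded_linear[OF bounded_linear_left p', of "Q t - Q0"] by (simp add: PQt)
  qed
  have split: "(\<integral>x. (\<integral>y. F x y \<partial>lborel) \<partial>lborel)
      = (\<integral>x. (\<integral>y. G x y \<partial>lborel) \<partial>lborel) + (\<integral>x. (\<integral>y. H x y \<partial>lborel) \<partial>lborel)"
  proof -
    have "F x y = G x y + H x y" for x y
      by (auto simp: G_def H_def not_le split: split_indicator)
    then have "case_prod F = (\<lambda>z. case_prod G z + case_prod H z)" by (auto simp: fun_eq_iff)
    then show ?thesis
      using intF intG intH
      by (simp add: lborel_pair.integral_fst Bochner_Integration.integral_add)
  qed
  have G: "(\<integral>x. (\<integral>y. G x y \<partial>lborel) \<partial>lborel) = (LINT x:{s..t}|lborel. pr (p x) (Q x - Q0))"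
    unfolding set_lebesgue_integral_def
  proof (rule Bochner_Integration.integral_cong[OF refl])
    fix x
    show "(\<integral>y. G x y \<partial>lborel) = indicator {s..t} x *\<^sub>R pr (p x) (Q x - Q0)"
    proof (cases "x \<in> {s..t}")
      case True
      have "(\<integral>y. G x y \<partial>lborel) = (\<integral>y. pr (p x) (indicator {s..x} y *\<^sub>R q y) \<partial>lborel)"
        using True by (intro Bochner_Integration.integral_cong)
          (auto simp: G_def F_def p'_def q'_def zero_right split: split_indicator)
      also have "\<dots> = pr (p x) (LINT y:{s..x}|lborel. q y)"
        unfolding set_lebesgue_integral_def
        using True set_integrable_Icc_subset[OF q, of s x]
        by (intro integral_bounded_linear[OF bounded_linear_right]) (simp add: set_integrable_def)
      finally show ?thesis using True Q[of x] by simp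
    qed (auto simp: G_def F_def p'_def zero_left)
  qed
  have "(\<integral>x. (\<integral>y. H x y \<partial>lborel) \<partial>lborel) = (\<integral>y. (\<integral>x. H x y \<partial>lborel) \<partial>lborel)"
    by (rule lborel_pair.Fubini_integral[OF intH, symmetric])
  also have "\<dots> = (LINT y:{s..t}|lborel. pr (P y - P0) (q y))"
    unfolding set_lebesgue_integral_def
  proof (rule Bochner_Integration.integral_cong[OF refl])
    fix y
    show "(\<integral>x. H x y \<partial>lborel) = indicator {s..t} y *\<^sub>R pr (P y - P0) (q y)"
    proof (cases "y \<in> {s..t}")
      case True
      have int: "integrable lborel (\<lambda>x. indicator {s..y} x *\<^sub>R p x)"
        using True set_integrable_Icc_subset[OF p, of s y] by (simp add: set_integrable_def)
      have "(\<integral>x. H x y \<partial>lborel) = (\<integral>x. pr (indicator {s..y} x *\<^sub>R p x) (q y) \<partial>lborel)"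
      proof (rule integral_cong_AE)
        show "AE x in lborel. H x y = pr (indicator {s..y} x *\<^sub>R p x) (q y)"
          \<comment> \<open>The open triangle gives \<open>x < y\<close>, the increment of
            \<open>P\<close> uses \<open>x \<le> y\<close>; one point makes the difference.\<close>
          using AE_lborel_singleton[of y]
          by eventually_elim (use True in \<open>auto simp: H_def F_def p'_def q'_def zero_left split: split_indicator\<close>)
        show "(\<lambda>x. pr (indicator {s..y} x *\<^sub>R p x) (q y)) \<in> borel_measurable lborel"
          using integrable_bounded_linear[OF bounded_linear_left int] by (rule borel_measurable_integrable)
        have "(\<lambda>x. indicator {..<y} x *\<^sub>R pr (p' x) (q' y)) \<in> borel_measurable lborel"
          using borel_measurable_integrable[OF integrable_bounded_linear[OF bounded_linear_left p']]
          by (intro borel_measurable_scaleR) auto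
        also have "(\<lambda>x. indicator {..<y} x *\<^sub>R pr (p' x) (q' y)) = (\<lambda>x. H x y)"
          by (auto simp: H_def F_def split: split_indicator)
        finally show "(\<lambda>x. H x y) \<in> borel_measurable lborel" .
      qed
      also have "\<dots> = pr (LINT x:{s..y}|lborel. p x) (q y)"
        unfolding set_lebesgue_integral_def
        by (rule integral_bounded_linear[OF bounded_linear_left int])
      finally show ?thesis using True P[of y] by simp
    qed (auto simp: H_def F_def q'_def zero_right)
  qed
  finally have H: "(\<integral>x. (\<integral>y. H x y \<partial>lborel) \<partial>lborel) = (LINT y:{s..t}|lborel. pr (P y - P0) (q y))" .
  have Pc: "continuous_on {s..t} P"
    by (rule continuous_on_cong[THEN iffD2, OF refl P])
      (auto intro!: continuous_intros continuous_on_set_integral_Icc p)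
  have Qc: "continuous_on {s..t} Q"
    by (rule continuous_on_cong[THEN iffD2, OF refl Q])
      (auto intro!: continuous_intros continuous_on_set_integral_Icc q)
  have i1: "set_integrable lborel {s..t} (\<lambda>r. pr (p r) (Q r))"
    by (rule set_integrable_bilinear_continuous[OF pr p Qc])
  have i2: "set_integrable lborel {s..t} (\<lambda>r. pr (P r) (q r))"
    by (rule set_integrable_continuous_bilinear[OF pr Pc q])
  have i3: "set_integrable lborel {s..t} (\<lambda>r. pr (p r) Q0)"
      "(LINT r:{s..t}|lborel. pr (p r) Q0) = pr (P t - P0) Q0"
    using set_integrable_bounded_linear[OF bounded_linear_left p]
      set_integral_bounded_linear[OF bounded_linear_left p, of Q0] P[of t] st by simp_all
  have i4: "set_integrable lborel {s..t} (\<lambda>r. pr P0 (q r))"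
      "(LINT r:{s..t}|lborel. pr P0 (q r)) = pr P0 (Q t - Q0)"
    using set_integrable_bounded_linear[OF bounded_linear_right q]
      set_integral_bounded_linear[OF bounded_linear_right q, of P0] Q[of t] st by simp_all
  have "pr (P t - P0) (Q t - Q0)
      = (LINT r:{s..t}|lborel. pr (p r) (Q r)) - pr (P t - P0) Q0
       + ((LINT r:{s..t}|lborel. pr (P r) (q r)) - pr P0 (Q t - Q0))"
    using total split G H i1 i2 i3 i4 by (simp add: diff_left diff_right)
  then show ?thesis using i1 i2 by (simp add: diff_left diff_right algebra_simps)
qed

text \<open>The comparison principle behind \<open>x \<le> y\<close>. Gronwall with constant 0 is
  applied to the total negative part \<open>V\<close>; quasi-positivity ensures that positive
  coordinates never push a negative one further down.\<close>

lemma quasipositive_linear_nonneg: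
  fixes w g :: "real \<Rightarrow> real^'n" and A :: "real \<Rightarrow> real^'n^'n"
  assumes A: "set_integrable lborel {s..t} A"
    and qp: "\<And>r i j. i \<noteq> j \<Longrightarrow> 0 \<le> A r $ i $ j"
    and w: "continuous_on {s..t} w" and g: "set_integrable lborel {s..t} g"
    and eq: "\<And>u. u \<in> {s..t} \<Longrightarrow> w u = w0 + (LINT r:{s..u}|lborel. A r *v w r + g r)"
    and w0: "nonneg w0" and g0: "AE r in lborel. r \<in> {s..t} \<longrightarrow> nonneg (g r)"
    and u: "u \<in> {s..t}"
  shows "nonneg (w u)"
proof -
  define N where "N = real CARD('n)"
  define V where "V = (\<lambda>r. \<Sum>i\<in>UNIV. max 0 (- (w r $ i)))"
  have V0: "0 \<le> V r" for r unfolding V_def by (intro sum_nonneg) auto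
  have Vc: "continuous_on {s..t} V" unfolding V_def by (intro continuous_intros w)
  have nA: "set_integrable lborel {s..t} (\<lambda>r. norm (A r))" using A by (rule set_integrable_norm)
  have NA: "set_integrable lborel {s..t} (\<lambda>r. N * norm (A r))" using nA by simp
  have AV: "set_integrable lborel {s..t} (\<lambda>r. norm (A r) * V r)"
    by (rule set_integrable_mult_continuous[OF nA Vc])
  have Aw: "set_integrable lborel {s..t} (\<lambda>r. A r *v w r + g r)"
    by (intro set_integral_add set_integrable_bilinear_continuous[OF bounded_bilinear_matrix_vector_mult A w] g)
  \<comment> \<open>Off the diagonal a nonnegative entry against a positive coordinate only helps,
    so just the negative parts count. On the diagonal the entry may have either sign, but there the
    coordinate itself is negative.\<close>
  have pointwise: "- ((A r *v w r) $ i) \<le> norm (A r) * V r" if "w r $ i < 0" for r i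
  proof -
    have "- ((A r *v w r) $ i) = (\<Sum>j\<in>UNIV. A r $ i $ j * (- (w r $ j)))"
      by (simp add: matrix_vector_mult_def sum_negf)
    also have "\<dots> \<le> (\<Sum>j\<in>UNIV. norm (A r) * max 0 (- (w r $ j)))"
    proof (rule sum_mono)
      fix j
      have le: "\<bar>A r $ i $ j\<bar> \<le> norm (A r)"
        using component_le_norm_cart[of "A r $ i" j] Finite_Cartesian_Product.norm_nth_le[of "A r" i] by linarith
      have "A r $ i $ j * (- (w r $ j)) \<le> \<bar>A r $ i $ j\<bar> * max 0 (- (w r $ j))"
      proof (cases "i = j")
        case True
        then show ?thesis using that by (intro mult_mono) auto
      next
        case False
        then show ?thesis using qp[OF False, of r]
            mult_left_mono[of "- (w r $ j)" "max 0 (- (w r $ j))" "A r $ i $ j"] by simp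
      qed
      also have "\<dots> \<le> norm (A r) * max 0 (- (w r $ j))" using le by (intro mult_right_mono) auto
      finally show "A r $ i $ j * (- (w r $ j)) \<le> norm (A r) * max 0 (- (w r $ j))" .
    qed
    finally show ?thesis by (simp add: V_def sum_distrib_left)
  qed
  have comp: "max 0 (- (w v $ i)) \<le> (LINT r:{s..v}|lborel. norm (A r) * V r)" if v: "v \<in> {s..t}" for v i
  proof (cases "0 \<le> w v $ i")
    case True
    then show ?thesis using V0 by (auto intro!: set_integral_nonneg_Icc)
  next
    case False
    have ws: "w s = w0" using eq[of s] v by simp
    have wic: "continuous_on {s..v} (\<lambda>r. w r $ i)"
      using v by (intro continuous_intros continuous_on_subset[OF w]) auto
    obtain p where p: "s \<le> p" "p \<le> v" "0 \<le> w p $ i" "\<And>q. p < q \<Longrightarrow> q \<le> v \<Longrightarrow> w q $ i < 0"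
      using last_nonneg_time[OF wic] w0 v ws unfolding nonneg_def by auto
    have int: "set_integrable lborel {p..v} (\<lambda>r. A r *v w r + g r)"
      using p v by (intro set_integrable_Icc_subset[OF Aw]) auto
    have "w v = w p + (LINT r:{p..v}|lborel. A r *v w r + g r)"
    proof -
      have pst: "p \<in> {s..t}" using p(1,2) v by simp
      have "w v = w0 + (LINT r:{s..v}|lborel. A r *v w r + g r)" by (rule eq[OF v])
      also have "(LINT r:{s..v}|lborel. A r *v w r + g r)
          = (LINT r:{s..p}|lborel. A r *v w r + g r) + (LINT r:{p..v}|lborel. A r *v w r + g r)"
        by (rule set_integral_Icc_split[OF set_integrable_Icc_subset[OF Aw]]) (use p(1,2) v in auto)
      also have "w0 + \<dots> = w p + (LINT r:{p..v}|lborel. A r *v w r + g r)"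
        unfolding eq[OF pst] by (rule add.assoc[symmetric])
      finally show ?thesis .
    qed
    then have "w v $ i = w p $ i + (LINT r:{p..v}|lborel. (A r *v w r + g r) $ i)"
      using set_integral_component[OF int, of i] by (metis vector_add_component)
    then have "- (w v $ i) \<le> (LINT r:{p..v}|lborel. - ((A r *v w r + g r) $ i))"
      using p(3) set_integral_uminus[OF set_integrable_component[OF int, of i]] by linarith
    also have "\<dots> \<le> (LINT r:{p..v}|lborel. norm (A r) * V r)"
    proof (rule set_integral_mono_AE)
      show "set_integrable lborel {p..v} (\<lambda>r. - ((A r *v w r + g r) $ i))"
        using set_integrable_component[OF int, of i]
          set_integrable_bounded_linear[OF bounded_linear_minus[OF bounded_linear_ident]] by blast
      show "set_integrable lborel {p..v} (\<lambda>r. norm (A r) * V r)"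
        using p v by (intro set_integrable_Icc_subset[OF AV]) auto
      show "AE r\<in>{p..v} in lborel. - ((A r *v w r + g r) $ i) \<le> norm (A r) * V r"
        using g0 AE_lborel_singleton[of p]
      proof eventually_elim
        case (elim r)
        show ?case
        proof
          assume r: "r \<in> {p..v}"
          then have "0 \<le> g r $ i" using elim p v by (auto simp: nonneg_def)
          moreover have "- ((A r *v w r) $ i) \<le> norm (A r) * V r"
            using r elim p(4) by (intro pointwise) auto
          ultimately show "- ((A r *v w r + g r) $ i) \<le> norm (A r) * V r" by simp
        qed
      qed
    qed
    also have "\<dots> \<le> (LINT r:{s..v}|lborel. norm (A r) * V r)"
    proof -
      have "0 \<le> (LINT r:{s..p}|lborel. norm (A r) * V r)" using V0 by (intro set_integral_nonneg_Icc) auto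
      moreover have "(LINT r:{s..v}|lborel. norm (A r) * V r)
          = (LINT r:{s..p}|lborel. norm (A r) * V r) + (LINT r:{p..v}|lborel. norm (A r) * V r)"
        using p v by (intro set_integral_Icc_split set_integrable_Icc_subset[OF AV]) auto
      ultimately show ?thesis by simp
    qed
    finally show ?thesis using False by simp
  qed
  have N0: "\<And>r. r \<in> {s..t} \<Longrightarrow> 0 \<le> N * norm (A r)" by (simp add: N_def)
  obtain M where "M \<ge> 1" and M: "\<And>u d t'. \<lbrakk>continuous_on {s..t} u; \<And>t'. t' \<in> {s..t} \<Longrightarrow> 0 \<le> u t'; 0 \<le> d;
       \<And>t'. t' \<in> {s..t} \<Longrightarrow> u t' \<le> d + (LINT r:{s..t'}|lborel. N * norm (A r) * u r); t' \<in> {s..t}\<rbrakk>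
       \<Longrightarrow> u t' \<le> M * d"
    using gronwall_L1[OF NA N0] by blast
  \<comment> \<open>Nonnegative initial data contribute nothing to the negative parts, so the
    Gronwall constant is 0; the factor \<open>N\<close> comes from summing \<open>comp\<close> over
    the coordinates.\<close>
  have "V u \<le> M * 0"
  proof (rule M[OF Vc V0 order_refl _ u])
    fix v assume v: "v \<in> {s..t}"
    have "V v \<le> (\<Sum>i\<in>(UNIV::'n set). (LINT r:{s..v}|lborel. norm (A r) * V r))"
      by (subst V_def) (rule sum_mono, rule comp[OF v])
    then show "V v \<le> 0 + (LINT r:{s..v}|lborel. N * norm (A r) * V r)"
      by (simp add: N_def mult.assoc)
  qed
  then have "V u = 0" using V0[of u] by simp
  then have "\<forall>i\<in>UNIV. max 0 (- (w u $ i)) = 0"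
    unfolding V_def by (subst (asm) sum_nonneg_eq_0_iff) auto
  then show ?thesis unfolding nonneg_def by (metis UNIV_I max.absorb_iff2 max_def neg_le_0_iff_le nle_le)
qed

section \<open>Inverse of the fundamental matrix and variation of constants\<close>

lemma matrix_inv_cancel:
  fixes A :: "real^'n^'n"
  assumes "invertible A"
  shows "A ** matrix_inv A = mat 1" "matrix_inv A ** A = mat 1"
  using someI_ex[of "\<lambda>A'. A ** A' = mat 1 \<and> A' ** A = mat 1"] assms
  unfolding invertible_def matrix_inv_def by auto

lemma continuous_on_det:
  fixes M :: "'a::topological_space \<Rightarrow> real^'n^'n"
  assumes "\<And>i j. continuous_on S (\<lambda>r. M r $ i $ j)"
  shows "continuous_on S (\<lambda>r. det (M r))"
  unfolding det_def by (intro continuous_intros assms)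

text \<open>By Cramer's rule the entries of the inverse are quotients of determinants with
  continuous entries and denominator \<open>det (M r)\<close>.\<close>

lemma continuous_on_matrix_inv:
  fixes M :: "'a::topological_space \<Rightarrow> real^'n^'n"
  assumes M: "continuous_on S M" and inv: "\<And>r. r \<in> S \<Longrightarrow> invertible (M r)"
  shows "continuous_on S (\<lambda>r. matrix_inv (M r))"
proof -
  have d: "det (M r) \<noteq> 0" if "r \<in> S" for r using inv[OF that] by (simp add: invertible_det_nz)
  have Mij: "continuous_on S (\<lambda>r. M r $ i $ j)" for i j by (intro continuous_intros M)
  let ?D = "\<lambda>r k j. det (\<chi> i j'. if j' = k then (axis j 1 :: real^'n) $ i else M r $ i $ j')"
  have entry: "matrix_inv (M r) $ k $ j = ?D r k j / det (M r)" if "r \<in> S" for r k j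
  proof -
    have "M r *v (matrix_inv (M r) *v axis j 1) = axis j 1"
      using matrix_inv_cancel[OF inv[OF that]] by (simp add: matrix_vector_mul_assoc)
    then have "matrix_inv (M r) *v axis j 1
        = (\<chi> k. det (\<chi> i j'. if j' = k then (axis j 1 :: real^'n) $ i else M r $ i $ j') / det (M r))"
      using cramer[OF d[OF that]] by blast
    then have "(matrix_inv (M r) *v axis j 1) $ k = ?D r k j / det (M r)" by simp
    then show ?thesis by (simp add: matrix_vector_mult_basis column_def)
  qed
  have "continuous_on S (\<lambda>r. ?D r k j / det (M r))" for k j
  proof (intro continuous_on_divide continuous_on_det)
    fix i j'
    show "continuous_on S (\<lambda>r. (\<chi> i j'. if j' = k then (axis j 1 :: real^'n) $ i else M r $ i $ j') $ i $ j')"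
      by (cases "j' = k") (auto intro: Mij)
  qed (use d Mij in auto)
  moreover have "continuous_on S (\<lambda>r. matrix_inv (M r) $ k $ j)
      \<longleftrightarrow> continuous_on S (\<lambda>r. ?D r k j / det (M r))" for k j
    by (rule continuous_on_cong[OF refl entry])
  ultimately have "continuous_on S (\<lambda>r. matrix_inv (M r) $ k $ j)" for k j
    by blast
  then have "continuous_on S (\<lambda>r. \<chi> k j. matrix_inv (M r) $ k $ j)"
    by (intro continuous_on_vec_lambda)
  then show ?thesis by simp
qed

text \<open>\<open>fundamental_matrix\<close> is based at time 0. For past times its equation is
  rewritten as one starting at \<open>s\<close>, the form that Gronwall and the product rule
  take.\<close>

lemma fundamental_matrix_past:
  assumes \<Phi>: "fundamental_matrix A \<Phi>" and u: "s \<le> u" "u \<le> 0"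
  shows "set_integrable lborel {s..u} (\<lambda>r. A r ** \<Phi> r)"
    and "\<Phi> u = \<Phi> s + (LINT r:{s..u}|lborel. A r ** \<Phi> r)"
proof -
  have int: "set_integrable lborel {v..0} (\<lambda>r. A r ** \<Phi> r)"
    and eq: "\<Phi> v = mat 1 - (LINT r:{v..0}|lborel. A r ** \<Phi> r)" if "v \<le> 0" for v
  proof -
    have "set_integrable lborel {min 0 v..max 0 v} (\<lambda>r. A r ** \<Phi> r)"
      "\<Phi> v = mat 1 + (if 0 \<le> v then (LINT r:{0..v}|lborel. A r ** \<Phi> r)
                      else - (LINT r:{v..0}|lborel. A r ** \<Phi> r))"
      using \<Phi> unfolding fundamental_matrix_def by blast+
    moreover have "min 0 v = v" "max 0 v = 0" using that by auto
    ultimately show "set_integrable lborel {v..0} (\<lambda>r. A r ** \<Phi> r)"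
      "\<Phi> v = mat 1 - (LINT r:{v..0}|lborel. A r ** \<Phi> r)"
      using that by (auto split: if_splits)
  qed
  have s: "s \<le> 0" using u by simp
  show "set_integrable lborel {s..u} (\<lambda>r. A r ** \<Phi> r)"
    using u by (intro set_integrable_Icc_subset[OF int[OF s]]) auto
  have "(LINT r:{s..0}|lborel. A r ** \<Phi> r)
      = (LINT r:{s..u}|lborel. A r ** \<Phi> r) + (LINT r:{u..0}|lborel. A r ** \<Phi> r)"
    by (rule set_integral_Icc_split[OF int[OF s] u])
  then show "\<Phi> u = \<Phi> s + (LINT r:{s..u}|lborel. A r ** \<Phi> r)"
    unfolding eq[OF s] eq[OF u(2)] by simp
qed

lemma bounded_linear_matrix_vector_left: "bounded_linear (\<lambda>M :: real^'n^'m. M *v v)"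
  by (rule bounded_bilinear.bounded_linear_left[OF bounded_bilinear_matrix_vector_mult])

text \<open>Needed to give \<open>matrix_inv\<close> its meaning. For \<open>v\<close> in the kernel
  of \<open>\<Phi> s\<close>, the curve \<open>\<Phi> r *v v\<close> starts from zero at
  \<open>s\<close>; Gronwall keeps it zero up to time 0, where \<open>\<Phi>\<close> is the
  identity.\<close>

lemma fundamental_matrix_invertible:
  fixes A :: "real \<Rightarrow> real^'n^'n"
  assumes \<Phi>: "fundamental_matrix A \<Phi>" and A: "set_integrable lborel {s..0} A" and s: "s \<le> 0"
  shows "invertible (\<Phi> s)"
proof -
  have cont: "continuous_on UNIV \<Phi>" using \<Phi> unfolding fundamental_matrix_def by blast
  have nA: "set_integrable lborel {s..0} (\<lambda>r. norm (A r))" using A by (rule set_integrable_norm)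
  obtain M where "M \<ge> 1" and M: "\<And>u d t. \<lbrakk>continuous_on {s..0} u; \<And>t. t \<in> {s..0} \<Longrightarrow> 0 \<le> u t; 0 \<le> d;
       \<And>t. t \<in> {s..0} \<Longrightarrow> u t \<le> d + (LINT r:{s..t}|lborel. norm (A r) * u r); t \<in> {s..0}\<rbrakk>
       \<Longrightarrow> u t \<le> M * d"
    using gronwall_L1[OF nA norm_ge_zero] by blast
  have "v = 0" if v: "\<Phi> s *v v = 0" for v
  proof -
    have cu: "continuous_on {s..0} (\<lambda>r. norm (\<Phi> r *v v))"
      by (intro continuous_intros bounded_linear.continuous_on[OF bounded_linear_matrix_vector_left]
          continuous_on_subset[OF cont]) auto
    have "norm (\<Phi> 0 *v v) \<le> M * 0"
    proof (rule M[OF cu])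
      fix t assume t: "t \<in> {s..0}"
      then have int: "set_integrable lborel {s..t} (\<lambda>r. A r ** \<Phi> r)"
        and eq: "\<Phi> t = \<Phi> s + (LINT r:{s..t}|lborel. A r ** \<Phi> r)"
        using fundamental_matrix_past[OF \<Phi>, of s t] by auto
      have "\<Phi> t *v v = (LINT r:{s..t}|lborel. (A r ** \<Phi> r) *v v)"
        unfolding set_integral_bounded_linear[OF bounded_linear_matrix_vector_left int]
        by (subst eq) (simp add: matrix_vector_mult_add_rdistrib v)
      also have "norm \<dots> \<le> (LINT r:{s..t}|lborel. norm (A r) * norm (\<Phi> r *v v))"
      proof (rule set_integral_norm_le)
        show "set_integrable lborel {s..t} (\<lambda>r. (A r ** \<Phi> r) *v v)"
          by (rule set_integrable_bounded_linear[OF bounded_linear_matrix_vector_left int])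
        show "set_integrable lborel {s..t} (\<lambda>r. norm (A r) * norm (\<Phi> r *v v))"
          using t by (intro set_integrable_Icc_subset[OF set_integrable_mult_continuous[OF nA cu]]) auto
        show "AE r in lborel. r \<in> {s..t} \<longrightarrow> norm ((A r ** \<Phi> r) *v v) \<le> norm (A r) * norm (\<Phi> r *v v)"
          by (simp add: norm_matrix_vector_mult_le flip: matrix_vector_mul_assoc)
      qed
      finally show "norm (\<Phi> t *v v) \<le> 0 + (LINT r:{s..t}|lborel. norm (A r) * norm (\<Phi> r *v v))" by simp
    qed (use s in auto)
    moreover have "\<Phi> 0 = mat 1"
    proof -
      have "\<Phi> 0 = mat 1 + (if (0::real) \<le> 0 then (LINT r:{0..0}|lborel. A r ** \<Phi> r)
                      else - (LINT r:{0..0}|lborel. A r ** \<Phi> r))"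
        using \<Phi> unfolding fundamental_matrix_def by blast
      then show ?thesis by simp
    qed
    ultimately show ?thesis by simp
  qed
  then show ?thesis
    unfolding invertible_left_inverse matrix_left_invertible_ker by blast
qed

text \<open>The product rule for \<open>\<Phi>\<close> against the bracket \<open>z\<close>: one
  term becomes \<open>A r *v y r\<close>, and in the other \<open>\<Phi> r\<close> cancels its
  inverse and leaves \<open>b r\<close>.\<close>

lemma variation_of_constants:
  fixes A :: "real \<Rightarrow> real^'n^'n" and b :: "real \<Rightarrow> real^'n" and x0 :: "real^'n"
  assumes \<Phi>: "fundamental_matrix A \<Phi>"
    and A: "\<And>a c. set_integrable lborel {a..c} A" and b: "\<And>a c. set_integrable lborel {a..c} b"
    and st: "s \<le> t" "t \<le> 0"
    and y_def: "y = (\<lambda>u. \<Phi> u *v (matrix_inv (\<Phi> s) *v x0 + (LINT q:{s..u}|lborel. matrix_inv (\<Phi> q) *v b q)))"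
  shows "set_integrable lborel {s..t} (\<lambda>q. matrix_inv (\<Phi> q) *v b q)"
    and "continuous_on {s..t} y"
    and "\<And>u. u \<in> {s..t} \<Longrightarrow> y u = x0 + (LINT r:{s..u}|lborel. A r *v y r + b r)"
proof -
  have cont: "continuous_on {s..t} \<Phi>"
    using \<Phi> unfolding fundamental_matrix_def by (blast intro: continuous_on_subset)
  have inv: "invertible (\<Phi> r)" if "r \<in> {s..t}" for r
    using that st by (intro fundamental_matrix_invertible[OF \<Phi> A]) auto
  have cinv: "continuous_on {s..t} (\<lambda>r. matrix_inv (\<Phi> r))"
    by (rule continuous_on_matrix_inv[OF cont inv])
  show int: "set_integrable lborel {s..t} (\<lambda>q. matrix_inv (\<Phi> q) *v b q)"
    by (rule set_integrable_continuous_bilinear[OF bounded_bilinear_matrix_vector_mult cinv b])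
  define z where "z = (\<lambda>u. matrix_inv (\<Phi> s) *v x0 + (LINT q:{s..u}|lborel. matrix_inv (\<Phi> q) *v b q))"
  have y: "y u = \<Phi> u *v z u" for u by (simp add: y_def z_def)
  have "continuous_on {s..t} z"
    unfolding z_def by (intro continuous_intros continuous_on_set_integral_Icc int)
  then show "continuous_on {s..t} y"
    unfolding y by (rule bounded_bilinear.continuous_on[OF bounded_bilinear_matrix_vector_mult cont])
  fix u assume u: "u \<in> {s..t}"
  have "\<Phi> u *v z u = \<Phi> s *v (matrix_inv (\<Phi> s) *v x0)
      + (LINT r:{s..u}|lborel. (A r ** \<Phi> r) *v z r + \<Phi> r *v (matrix_inv (\<Phi> r) *v b r))"
  proof (rule integral_product_rule[OF bounded_bilinear_matrix_vector_mult])
    show "set_integrable lborel {s..u} (\<lambda>r. A r ** \<Phi> r)"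
      using u st by (intro fundamental_matrix_past[OF \<Phi>]) auto
    show "set_integrable lborel {s..u} (\<lambda>r. matrix_inv (\<Phi> r) *v b r)"
      using u by (intro set_integrable_Icc_subset[OF int]) auto
    show "\<Phi> v = \<Phi> s + (LINT r:{s..v}|lborel. A r ** \<Phi> r)" if "v \<in> {s..u}" for v
      using u st that by (intro fundamental_matrix_past[OF \<Phi>]) auto
  qed (use u in \<open>auto simp: z_def\<close>)
  also have "\<Phi> s *v (matrix_inv (\<Phi> s) *v x0) = x0"
    using matrix_inv_cancel[OF inv, of s] st by (simp add: matrix_vector_mul_assoc)
  also have "(LINT r:{s..u}|lborel. (A r ** \<Phi> r) *v z r + \<Phi> r *v (matrix_inv (\<Phi> r) *v b r))
      = (LINT r:{s..u}|lborel. A r *v y r + b r)"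
  proof (rule set_lebesgue_integral_cong)
    show "\<forall>r. r \<in> {s..u} \<longrightarrow> (A r ** \<Phi> r) *v z r + \<Phi> r *v (matrix_inv (\<Phi> r) *v b r) = A r *v y r + b r"
      using matrix_inv_cancel[OF inv] u by (simp add: y matrix_vector_mul_assoc)
  qed simp
  finally show "y u = x0 + (LINT r:{s..u}|lborel. A r *v y r + b r)" by (simp only: y)
qed

text \<open>The unit windows counted back from \<open>t\<close> carry weights bounded by the powers
  of \<open>exp (- \<alpha>)\<close>; the bound is \<open>C\<close> times the sum of this geometric
  series.\<close>

lemma exp_weighted_integral_bound:
  fixes \<beta> :: "real \<Rightarrow> real"
  assumes \<beta>: "\<And>a c. set_integrable lborel {a..c} \<beta>" and \<beta>0: "\<And>r. 0 \<le> \<beta> r" and \<alpha>: "\<alpha> > 0"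
    and C: "\<And>t. (LINT r:{t - 1..t}|lborel. \<beta> r) \<le> C"
  shows "(LINT q:{s..t}|lborel. exp (- \<alpha> * (t - q)) * \<beta> q) \<le> C / (1 - exp (- \<alpha>))"
proof -
  define D where "D = C / (1 - exp (- \<alpha>))"
  have e: "exp (- \<alpha>) < 1" using \<alpha> by simp
  \<comment> \<open>\<open>D\<close> is the fixed point of adding one more window, which closes the
    induction.\<close>
  have D: "C + exp (- \<alpha>) * D = D" unfolding D_def using e by (simp add: field_simps)
  have C0: "0 \<le> C" using C[of 0] set_integral_nonneg_Icc[of "-1" 0 \<beta>] \<beta>0 by (auto intro: order_trans)
  have int: "set_integrable lborel {a..c} (\<lambda>q. exp (- \<alpha> * (t - q)) * \<beta> q)" for a c t
  proof -
    have "continuous_on {a..c} (\<lambda>q. exp (- \<alpha> * (t - q)))" by (intro continuous_intros)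
    from set_integrable_mult_continuous[OF \<beta> this] show ?thesis by (simp add: mult.commute)
  qed
  have step: "(LINT q:{t - real n..t}|lborel. exp (- \<alpha> * (t - q)) * \<beta> q) \<le> D" for n t
  proof (induction n arbitrary: t)
    case 0
    then show ?case using C0 e by (simp add: D_def)
  next
    case (Suc n)
    have "(LINT q:{t - real (Suc n)..t}|lborel. exp (- \<alpha> * (t - q)) * \<beta> q)
       = (LINT q:{t - real (Suc n)..t - 1}|lborel. exp (- \<alpha> * (t - q)) * \<beta> q)
        + (LINT q:{t - 1..t}|lborel. exp (- \<alpha> * (t - q)) * \<beta> q)"
      by (rule set_integral_Icc_split[OF int]) auto
    also have "(LINT q:{t - 1..t}|lborel. exp (- \<alpha> * (t - q)) * \<beta> q) \<le> (LINT q:{t - 1..t}|lborel. \<beta> q)"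
    proof (rule set_integral_mono[OF int \<beta>])
      fix q assume "q \<in> {t - 1..t}"
      then have "exp (- \<alpha> * (t - q)) \<le> 1" using \<alpha> by (simp add: mult_nonneg_nonneg)
      then show "exp (- \<alpha> * (t - q)) * \<beta> q \<le> \<beta> q" using \<beta>0[of q] by (simp add: mult_left_le_one_le)
    qed
    also have "\<dots> \<le> C" by (rule C)
    \<comment> \<open>Moving the end point from \<open>t\<close> to \<open>t - 1\<close> costs one
      factor \<open>exp (- \<alpha>)\<close>; for this the induction is over all
      \<open>t\<close>.\<close>
    also have "(LINT q:{t - real (Suc n)..t - 1}|lborel. exp (- \<alpha> * (t - q)) * \<beta> q)
        = exp (- \<alpha>) * (LINT q:{(t - 1) - real n..t - 1}|lborel. exp (- \<alpha> * ((t - 1) - q)) * \<beta> q)"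
    proof -
      have "exp (- \<alpha> * (t - q)) * \<beta> q = exp (- \<alpha>) * (exp (- \<alpha> * ((t - 1) - q)) * \<beta> q)" for q
        by (simp add: algebra_simps flip: exp_add mult.assoc)
      moreover have "t - real (Suc n) = (t - 1) - real n" by simp
      ultimately show ?thesis by (simp only: set_integral_mult_right)
    qed
    also have "\<dots> \<le> exp (- \<alpha>) * D" by (intro mult_left_mono Suc.IH) simp
    finally show ?case using D by simp
  qed
  obtain n :: nat where n: "t - s \<le> real n" using real_arch_simple by blast
  show ?thesis
  proof (cases "s \<le> t")
    case True
    have "(LINT q:{t - real n..t}|lborel. exp (- \<alpha> * (t - q)) * \<beta> q)
       = (LINT q:{t - real n..s}|lborel. exp (- \<alpha> * (t - q)) * \<beta> q)
        + (LINT q:{s..t}|lborel. exp (- \<alpha> * (t - q)) * \<beta> q)"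
      using n True by (intro set_integral_Icc_split[OF int]) auto
    moreover have "0 \<le> (LINT q:{t - real n..s}|lborel. exp (- \<alpha> * (t - q)) * \<beta> q)"
      using \<beta>0 by (intro set_integral_nonneg_Icc) auto
    ultimately show ?thesis using step[of t n] by (simp add: D_def)
  next
    case False
    then show ?thesis using C0 e by (simp add: D_def set_lebesgue_integral_def)
  qed
qed

text \<open>Turns the centred windows of (A4), where \<open>t\<close> stands in the argument of
  \<open>b\<close>, into integrals over intervals around \<open>t\<close>.\<close>

lemma set_integral_translate:
  fixes h :: "real \<Rightarrow> real"
  shows "(LINT s:{a..c}|lborel. h (s + t)) = (LINT r:{a + t..c + t}|lborel. h r)"
proof -
  have "(LINT r:{a + t..c + t}|lborel. h r)
      = (\<integral>x. indicator {a + t..c + t} (t + 1 * x) *\<^sub>R h (t + 1 * x) \<partial>lborel)"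
    unfolding set_lebesgue_integral_def
    using lborel_integral_real_affine[of 1 "\<lambda>x. indicator {a + t..c + t} x *\<^sub>R h x" t] by simp
  also have "\<dots> = (LINT s:{a..c}|lborel. h (s + t))"
    unfolding set_lebesgue_integral_def
    by (rule Bochner_Integration.integral_cong) (auto simp: add.commute split: split_indicator)
  finally show ?thesis by simp
qed

context sublinear_LC
begin

lemma Sf_exponential_bound:
  assumes qp: "\<And>t i j. i \<noteq> j \<Longrightarrow> 0 \<le> A t $ i $ j"
    and \<Phi>: "fundamental_matrix A \<Phi>"
    and decay: "\<And>s t. s \<le> t \<Longrightarrow> t \<le> 0 \<Longrightarrow>
           onorm (\<lambda>v. (\<Phi> t ** matrix_inv (\<Phi> s)) *v v) \<le> K * exp (- \<alpha> * (t - s))"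
    and st: "s \<le> t" "t \<le> 0" and x0: "nonneg x0"
  shows "norm (Sf f t s x0) \<le> K * exp (- \<alpha> * (t - s)) * norm x0
      + K * (LINT q:{s..t}|lborel. exp (- \<alpha> * (t - q)) * norm (b q))"
proof -
  define x where "x = (\<lambda>u. Sf f u s x0)"
  have sol: "is_solution f s x0 t x" unfolding x_def by (rule Sf_solution[OF st(1) x0])
  have nn: "nonneg (x u)" if "s \<le> u" for u unfolding x_def by (rule Sf_nonneg[OF that x0])
  define y where "y = (\<lambda>u. \<Phi> u *v (matrix_inv (\<Phi> s) *v x0 + (LINT q:{s..u}|lborel. matrix_inv (\<Phi> q) *v b q)))"
  note voc = variation_of_constants[OF \<Phi> A_int b_int st y_def]
  have xc: "continuous_on {s..t} x" by (rule is_solutionD[OF sol])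
  \<comment> \<open>The slack of (A2) along the trajectory. It is the forcing in the linear equation
    for \<open>y - x\<close>, and nonnegative almost everywhere because \<open>x\<close> stays in
    the orthant.\<close>
  define g where "g = (\<lambda>r. A r *v x r + b r - f r (x r))"
  have Ax: "set_integrable lborel {s..t} (\<lambda>r. A r *v x r)"
    by (rule set_integrable_bilinear_continuous[OF bounded_bilinear_matrix_vector_mult A_int xc])
  have Ay: "set_integrable lborel {s..t} (\<lambda>r. A r *v y r)"
    by (rule set_integrable_bilinear_continuous[OF bounded_bilinear_matrix_vector_mult A_int voc(2)])
  have fx: "set_integrable lborel {s..t} (\<lambda>r. f r (x r))"
    using is_solutionD(3)[OF sol] st by simp
  have gi: "set_integrable lborel {s..t} g"
    unfolding g_def by (intro set_integral_diff set_integral_add Ax b_int fx)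
  have "nonneg (y t - x t)"
  proof (rule quasipositive_linear_nonneg[OF A_int[of s t] qp _ gi])
    show "continuous_on {s..t} (\<lambda>r. y r - x r)" by (intro continuous_intros xc voc)
    show "nonneg (0 :: real^'n)" by (simp add: nonneg_def)
    show "AE r in lborel. r \<in> {s..t} \<longrightarrow> nonneg (g r)"
      using AE_upper
    proof eventually_elim
      case (elim r)
      show ?case using elim nn[of r] by (auto simp: g_def nonneg_def vle_def)
    qed
    show "t \<in> {s..t}" using st by simp
    fix u assume u: "u \<in> {s..t}"
    have i: "set_integrable lborel {s..u} (\<lambda>r. A r *v y r + b r)" "set_integrable lborel {s..u} (\<lambda>r. f r (x r))"
      using u by (auto intro!: set_integrable_Icc_subset[OF fx] set_integrable_Icc_subset[OF Ay] b_int set_integral_add)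
    have xu: "x u = x0 + (LINT r:{s..u}|lborel. f r (x r))"
      using u by (intro is_solutionD(4)[OF sol]) auto
    have "y u - x u = (LINT r:{s..u}|lborel. A r *v y r + b r) - (LINT r:{s..u}|lborel. f r (x r))"
      unfolding voc(3)[OF u] xu by (rule add_diff_cancel_left)
    also have "\<dots> = (LINT r:{s..u}|lborel. (A r *v y r + b r) - f r (x r))"
      by (rule set_integral_diff(2)[OF i, symmetric])
    also have "(\<lambda>r. (A r *v y r + b r) - f r (x r)) = (\<lambda>r. A r *v (y r - x r) + g r)"
      by (simp add: g_def matrix_vector_mult_diff_distrib algebra_simps)
    finally show "y u - x u = 0 + (LINT r:{s..u}|lborel. A r *v (y r - x r) + g r)" by simp
  qed
  \<comment> \<open>The order \<open>x t \<le> y t\<close> carries over to norms because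
    \<open>x t\<close> is nonnegative.\<close>
  then have "norm (x t) \<le> norm (y t)"
    using nn[OF st(1)] by (intro norm_le_componentwise_cart) (auto simp: nonneg_def intro: order_trans[OF _ abs_ge_self])
  also have "y t = \<Phi> t *v (matrix_inv (\<Phi> s) *v x0) + (LINT q:{s..t}|lborel. \<Phi> t *v (matrix_inv (\<Phi> q) *v b q))"
    unfolding y_def
    by (simp add: matrix_vector_right_distrib
        set_integral_bounded_linear[OF matrix_vector_mul_bounded_linear voc(1)])
  also have "norm \<dots> \<le> norm (\<Phi> t *v (matrix_inv (\<Phi> s) *v x0))
      + norm (LINT q:{s..t}|lborel. \<Phi> t *v (matrix_inv (\<Phi> q) *v b q))"
    by (rule norm_triangle_ineq)
  also have "\<dots> \<le> K * exp (- \<alpha> * (t - s)) * norm x0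
      + (LINT q:{s..t}|lborel. K * (exp (- \<alpha> * (t - q)) * norm (b q)))"
  proof (rule add_mono)
    \<comment> \<open>Used with \<open>q = s\<close> for the initial value and with every
      \<open>q\<close> under the integral for the forcing.\<close>
    have op: "norm (\<Phi> t *v (matrix_inv (\<Phi> q) *v v)) \<le> K * exp (- \<alpha> * (t - q)) * norm v"
      if "q \<le> t" for q v
    proof -
      have "norm ((\<Phi> t ** matrix_inv (\<Phi> q)) *v v)
          \<le> onorm (\<lambda>v. (\<Phi> t ** matrix_inv (\<Phi> q)) *v v) * norm v"
        by (rule onorm[OF matrix_vector_mul_bounded_linear])
      also have "\<dots> \<le> K * exp (- \<alpha> * (t - q)) * norm v"
        by (intro mult_right_mono decay that st norm_ge_zero)
      finally show ?thesis by (simp add: matrix_vector_mul_assoc)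
    qed
    then show "norm (\<Phi> t *v (matrix_inv (\<Phi> s) *v x0)) \<le> K * exp (- \<alpha> * (t - s)) * norm x0"
      using st by blast
    show "norm (LINT q:{s..t}|lborel. \<Phi> t *v (matrix_inv (\<Phi> q) *v b q))
        \<le> (LINT q:{s..t}|lborel. K * (exp (- \<alpha> * (t - q)) * norm (b q)))"
    proof (rule set_integral_norm_le)
      show "set_integrable lborel {s..t} (\<lambda>q. \<Phi> t *v (matrix_inv (\<Phi> q) *v b q))"
        by (rule set_integrable_bounded_linear[OF matrix_vector_mul_bounded_linear voc(1)])
      have "continuous_on {s..t} (\<lambda>q. exp (- \<alpha> * (t - q)))" by (intro continuous_intros)
      from set_integrable_mult_continuous[OF set_integrable_norm[OF b_int] this]
      have "set_integrable lborel {s..t} (\<lambda>q. exp (- \<alpha> * (t - q)) * norm (b q))"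
        by (simp add: mult.commute)
      then show "set_integrable lborel {s..t} (\<lambda>q. K * (exp (- \<alpha> * (t - q)) * norm (b q)))"
        by (rule set_integrable_mult_right)
      show "AE q in lborel. q \<in> {s..t} \<longrightarrow> norm (\<Phi> t *v (matrix_inv (\<Phi> q) *v b q))
          \<le> K * (exp (- \<alpha> * (t - q)) * norm (b q))"
        using op by (auto simp: mult.assoc)
    qed
  qed
  finally show ?thesis by (simp add: x_def)
qed

end

section \<open>Pullback attractors of strongly dissipative processes\<close>

text \<open>In \<open>absorbing\<close> one \<open>T\<close> serves all
  \<open>t \<le> \<tau>\<close>, with the single target \<open>B \<tau>\<close>; at
  \<open>t = \<tau>\<close> it contains ordinary pullback absorption. The uniformity is what lets
  omega-limits of different bounded sets be compared.\<close>

locale dissipative_process =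
  fixes S :: "real \<Rightarrow> real \<Rightarrow> 'a::heine_borel \<Rightarrow> 'a" and X :: "'a set" and B :: "real \<Rightarrow> 'a set"
  assumes maps: "s \<le> t \<Longrightarrow> x \<in> X \<Longrightarrow> S t s x \<in> X"
    and cocycle: "s \<le> r \<Longrightarrow> r \<le> t \<Longrightarrow> x \<in> X \<Longrightarrow> S t s x = S t r (S r s x)"
    and cont: "s \<le> t \<Longrightarrow> continuous_on X (S t s)"
    and compact_B: "compact (B t)"
    and B_subset: "B t \<subseteq> X"
    and absorbing: "bounded D \<Longrightarrow> D \<subseteq> X \<Longrightarrow>
      \<exists>T>0. \<forall>t\<le>\<tau>. \<forall>s\<ge>T. S t (t - s) ` D \<subseteq> B \<tau>"
begin

text \<open>The pullback omega-limit set, the intersection over \<open>\<sigma>\<close> of the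
  closures of all images of \<open>D\<close> under \<open>S t s\<close> with
  \<open>s \<le> \<sigma>\<close>, spelled out pointwise.\<close>

definition omega :: "real \<Rightarrow> 'a set \<Rightarrow> 'a set" where
  "omega t D = {y. \<forall>e>0. \<forall>\<sigma>. \<exists>s\<le>\<sigma>. \<exists>x\<in>D. dist (S t s x) y < e}"

lemma closed_omega: "closed (omega t D)"
  unfolding closed_limpt islimpt_approachable
proof (intro allI impI)
  fix z assume z: "\<forall>e>0. \<exists>x'\<in>omega t D. x' \<noteq> z \<and> dist x' z < e"
  show "z \<in> omega t D" unfolding omega_def
  proof (safe)
    fix e \<sigma> :: real assume "0 < e"
    then obtain y where y: "y \<in> omega t D" "dist y z < e / 2" using z half_gt_zero[OF \<open>0 < e\<close>] by blast
    with half_gt_zero[OF \<open>0 < e\<close>] obtain s x where "s \<le> \<sigma>" "x \<in> D" "dist (S t s x) y < e / 2"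
      unfolding omega_def by blast
    with y show "\<exists>s\<le>\<sigma>. \<exists>x\<in>D. dist (S t s x) z < e"
      using dist_triangle_half_r[of y "S t s x" e z] by (auto simp: dist_commute intro!: exI[of _ s] bexI[of _ x])
  qed
qed

text \<open>An orbit starting early enough in \<open>D\<close> passes through
  \<open>B \<tau>\<close> at the intermediate time \<open>s + T\<close> and can be regarded as
  starting there. One \<open>T\<close> has to serve all these intermediate times, which uses the
  uniformity of \<open>absorbing\<close>.\<close>

lemma omega_absorbed:
  assumes D: "bounded D" "D \<subseteq> X" and t: "t \<le> \<tau>"
  shows "omega t D \<subseteq> omega t (B \<tau>)"
proof
  fix y assume y: "y \<in> omega t D"
  obtain T where T: "T > 0" "\<And>t s. t \<le> \<tau> \<Longrightarrow> s \<ge> T \<Longrightarrow> S t (t - s) ` D \<subseteq> B \<tau>"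
    using absorbing[OF D, of \<tau>] by blast
  show "y \<in> omega t (B \<tau>)" unfolding omega_def
  proof safe
    fix e \<sigma> :: real assume "0 < e"
    \<comment> \<open>Subtracting \<open>T\<close> leaves room for both
      \<open>s + T \<le> \<sigma>\<close> and \<open>s + T \<le> t\<close>.\<close>
    then obtain s x where s: "s \<le> min \<sigma> t - T" "x \<in> D" "dist (S t s x) y < e"
      using y unfolding omega_def by blast
    have "S t s x = S t (s + T) (S (s + T) s x)"
      using s T D by (intro cocycle) auto
    moreover have "S (s + T) (s + T - T) ` D \<subseteq> B \<tau>"
      using s T(1) t by (intro T(2)) auto
    ultimately show "\<exists>s\<le>\<sigma>. \<exists>x\<in>B \<tau>. dist (S t s x) y < e"
      using s by (intro exI[of _ "s + T"] conjI bexI[of _ "S (s + T) s x"]) auto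
  qed
qed

text \<open>At time \<open>t\<close>, orbits started before \<open>t - T\<close> are in the closed
  set \<open>B \<tau>\<close>, and so are their limits. As \<open>\<tau>\<close> may exceed
  \<open>t\<close>, one set contains the whole past.\<close>

lemma omega_subset_B:
  assumes D: "bounded D" "D \<subseteq> X" and t: "t \<le> \<tau>"
  shows "omega t D \<subseteq> B \<tau>"
proof
  fix y assume y: "y \<in> omega t D"
  obtain T where T: "T > 0" "\<And>t s. t \<le> \<tau> \<Longrightarrow> s \<ge> T \<Longrightarrow> S t (t - s) ` D \<subseteq> B \<tau>"
    using absorbing[OF D, of \<tau>] by blast
  have "y \<in> closure (B \<tau>)" unfolding closure_approachable
  proof safe
    fix e :: real assume "0 < e"
    then obtain s x where s: "s \<le> t - T" "x \<in> D" "dist (S t s x) y < e"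
      using y unfolding omega_def by blast
    moreover have "S t (t - (t - s)) ` D \<subseteq> B \<tau>" using s t by (intro T(2)) auto
    ultimately show "\<exists>y'\<in>B \<tau>. dist y' y < e" by auto
  qed
  then show "y \<in> B \<tau>" using compact_B[of \<tau>] by (simp add: compact_imp_closed closure_closed)
qed

text \<open>Pullback asymptotic compactness: late terms lie in the compact set \<open>B t\<close>,
  and a cluster point reached with start times tending to minus infinity is in the
  omega-limit.\<close>

lemma omega_limit_point:
  assumes D: "bounded D" "D \<subseteq> X" and x: "\<And>n. x n \<in> D" and s: "filterlim s at_bot sequentially"
  obtains y k where "y \<in> omega t D" "strict_mono k" "(\<lambda>n. S t (s (k n)) (x (k n))) \<longlonglongrightarrow> y"
proof -
  obtain T where T: "T > 0" "\<And>r. r \<ge> T \<Longrightarrow> S t (t - r) ` D \<subseteq> B t"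
    using absorbing[OF D, of t] by blast
  have "eventually (\<lambda>n. s n \<le> t - T) sequentially"
    using s by (simp add: filterlim_at_bot)
  then obtain N where N: "\<And>n. n \<ge> N \<Longrightarrow> s n \<le> t - T" by (auto simp: eventually_sequentially)
  have "S t (s (n + N)) (x (n + N)) \<in> B t" for n
    using T(2)[of "t - s (n + N)"] N[of "n + N"] x[of "n + N"] by auto
  then obtain y k where k: "y \<in> B t" "strict_mono k"
      "((\<lambda>n. S t (s (n + N)) (x (n + N))) \<circ> k) \<longlonglongrightarrow> y"
    using compact_B[of t] unfolding compact_def by meson
  \<comment> \<open>The shift by \<open>N\<close> skips the finitely many terms that may not be
    absorbed yet.\<close>
  let ?k = "\<lambda>n. k n + N"
  have mono: "strict_mono ?k" using k(2) by (auto simp: strict_mono_def)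
  have lim: "(\<lambda>n. S t (s (?k n)) (x (?k n))) \<longlonglongrightarrow> y" using k(3) by (simp add: o_def)
  have "y \<in> omega t D" unfolding omega_def
  proof safe
    fix e \<sigma> :: real assume "0 < e"
    have "eventually (\<lambda>n. s (?k n) \<le> \<sigma>) sequentially"
      using filterlim_compose[OF s filterlim_subseq[OF mono]] by (simp add: filterlim_at_bot)
    with tendstoD[OF lim \<open>0 < e\<close>]
    have "eventually (\<lambda>n. dist (S t (s (?k n)) (x (?k n))) y < e \<and> s (?k n) \<le> \<sigma>) sequentially"
      by eventually_elim simp
    then obtain n where "dist (S t (s (?k n)) (x (?k n))) y < e \<and> s (?k n) \<le> \<sigma>"
      by (auto simp: eventually_sequentially)
    then show "\<exists>s\<le>\<sigma>. \<exists>x\<in>D. dist (S t s x) y < e" using x by blast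
  qed
  then show ?thesis using mono lim by (rule that)
qed

text \<open>The bound \<open>c\<close> keeps the start times before a prescribed intermediate time,
  so that the cocycle property can be applied there.\<close>

lemma omega_sequence:
  assumes "y \<in> omega t D"
  obtains s x where "\<And>n. x n \<in> D" "\<And>n. s n \<le> c" "filterlim s at_bot sequentially"
    "(\<lambda>n. S t (s n) (x n)) \<longlonglongrightarrow> y"
proof -
  have "\<forall>n::nat. \<exists>s x. s \<le> min c (- real n) \<and> x \<in> D \<and> dist (S t s x) y < inverse (real (Suc n))"
  proof
    fix n :: nat
    have "0 < inverse (real (Suc n))" by simp
    then show "\<exists>s x. s \<le> min c (- real n) \<and> x \<in> D \<and> dist (S t s x) y < inverse (real (Suc n))"
      using assms unfolding omega_def by blast
  qed
  then obtain s x where sx: "\<And>n. s n \<le> min c (- real n)" "\<And>n. x n \<in> D"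
      "\<And>n. dist (S t (s n) (x n)) y < inverse (real (Suc n))"
    by metis
  have "filterlim (\<lambda>n. - real n) at_bot sequentially"
    by (simp add: filterlim_uminus_at_bot filterlim_real_sequentially)
  then have 1: "filterlim s at_bot sequentially"
    by (rule filterlim_at_bot_mono) (use sx(1) in simp)
  have le: "dist (S t (s n) (x n)) y \<le> inverse (real (Suc n))" for n
    using sx(3) by (rule less_imp_le)
  have "(\<lambda>n. dist (S t (s n) (x n)) y) \<longlonglongrightarrow> 0"
    by (rule Lim_null_comparison[OF always_eventually LIMSEQ_inverse_real_of_nat]) (use le in simp)
  then have 2: "(\<lambda>n. S t (s n) (x n)) \<longlonglongrightarrow> y" by (rule tendsto_dist_iff[THEN iffD2])
  show ?thesis using sx(1,2) 1 2 by (intro that[of x s]) simp_all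
qed

text \<open>Otherwise there are start times tending to minus infinity whose images stay
  \<open>e\<close> away from the omega-limit; a cluster point of them lies in
  \<open>omega t D\<close>, hence in \<open>omega t (B t)\<close>.\<close>

lemma pullback_attracts_omega: "pullback_attracts S X (\<lambda>t. omega t (B t))"
  unfolding pullback_attracts_def
proof (intro allI impI, elim conjE, rule ccontr)
  fix t D and e :: real
  assume D: "bounded D" "D \<subseteq> X" and "e > 0"
  assume "\<not> eventually (\<lambda>s. \<forall>y\<in>S t s ` D. \<exists>a\<in>omega t (B t). dist y a < e) at_bot"
  then have *: "\<not> (\<exists>N. \<forall>s\<le>N. \<forall>y\<in>S t s ` D. \<exists>a\<in>omega t (B t). dist y a < e)"
    unfolding eventually_at_bot_linorder by simp
  have "\<exists>s x. s \<le> - real n \<and> x \<in> D \<and> (\<forall>a\<in>omega t (B t). \<not> dist (S t s x) a < e)" for n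
  proof -
    have "\<not> (\<forall>s\<le>- real n. \<forall>y\<in>S t s ` D. \<exists>a\<in>omega t (B t). dist y a < e)" using * by simp
    then show ?thesis by auto
  qed
  then obtain s x where sx: "\<And>n. s n \<le> - real n" "\<And>n. x n \<in> D"
      "\<And>n a. a \<in> omega t (B t) \<Longrightarrow> \<not> dist (S t (s n) (x n)) a < e"
    by metis
  have "filterlim (\<lambda>n. - real n) at_bot sequentially"
    by (simp add: filterlim_uminus_at_bot filterlim_real_sequentially)
  then have s: "filterlim s at_bot sequentially"
    by (rule filterlim_at_bot_mono) (use sx(1) in auto)
  obtain y k where y: "y \<in> omega t D" "(\<lambda>n. S t (s (k n)) (x (k n))) \<longlonglongrightarrow> y"
    by (rule omega_limit_point[OF D sx(2) s])
  have "y \<in> omega t (B t)" using omega_absorbed[OF D order_refl] y by auto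
  moreover obtain n where "dist (S t (s (k n)) (x (k n))) y < e"
    using tendstoD[OF y(2) \<open>e > 0\<close>] by (auto simp: eventually_sequentially)
  ultimately show False using sx(3) by blast
qed

text \<open>Either inclusion represents a point by a sequence, extracts a limit at the other time,
  and matches the two by continuity of \<open>S t s\<close>. The limit lies in the omega-limit of
  \<open>B\<close> taken at the wrong time; \<open>omega_absorbed\<close> corrects this.\<close>

lemma omega_invariant:
  assumes st: "s \<le> t"
  shows "S t s ` omega s (B s) = omega t (B t)"
proof
  have bdd: "bounded (B r)" for r using compact_B by (rule compact_imp_bounded)
  have seqcont: "(\<lambda>n. S t s (z n)) \<longlonglongrightarrow> S t s y"
    if "z \<longlonglongrightarrow> y" "\<And>n. z n \<in> X" "y \<in> X" for z y
    using cont[OF st] that by (auto simp: continuous_on_sequentially o_def)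
  have omX: "omega r D \<subseteq> X" if "bounded D" "D \<subseteq> X" for r D
    using omega_subset_B[OF that order_refl] B_subset by blast
  show "S t s ` omega s (B s) \<subseteq> omega t (B t)"
  proof safe
    fix y assume y: "y \<in> omega s (B s)"
    then obtain q x where q: "\<And>n. x n \<in> B s" "\<And>n. q n \<le> s" "filterlim q at_bot sequentially"
        "(\<lambda>n. S s (q n) (x n)) \<longlonglongrightarrow> y"
      using omega_sequence[of y s "B s" s] by metis
    have xX: "x n \<in> X" for n using q(1) B_subset by blast
    have "(\<lambda>n. S t s (S s (q n) (x n))) \<longlonglongrightarrow> S t s y"
      by (rule seqcont[OF q(4) maps[OF q(2) xX]]) (use y omX[OF bdd B_subset] in blast)
    then have lim: "(\<lambda>n. S t (q n) (x n)) \<longlonglongrightarrow> S t s y"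
      using cocycle[OF q(2) st xX] by simp
    obtain z k where z: "z \<in> omega t (B s)" "strict_mono k" "(\<lambda>n. S t (q (k n)) (x (k n))) \<longlonglongrightarrow> z"
      using omega_limit_point[where D = "B s" and x = x and s = q and t = t, OF bdd B_subset q(1) q(3)] by metis
    have "z = S t s y"
      using LIMSEQ_unique[OF z(3)] LIMSEQ_subseq_LIMSEQ[OF lim z(2)] by (simp add: o_def)
    then show "S t s y \<in> omega t (B t)"
      using z(1) omega_absorbed[OF bdd B_subset order_refl] by blast
  qed
  show "omega t (B t) \<subseteq> S t s ` omega s (B s)"
  proof
    fix z assume z: "z \<in> omega t (B t)"
    then obtain q x where q: "\<And>n. x n \<in> B t" "\<And>n. q n \<le> s" "filterlim q at_bot sequentially"
        "(\<lambda>n. S t (q n) (x n)) \<longlonglongrightarrow> z"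
      using omega_sequence[of z t "B t" s] by metis
    have xX: "x n \<in> X" for n using q(1) B_subset by blast
    \<comment> \<open>Asymptotic compactness at the earlier time \<open>s\<close> provides the
      preimage.\<close>
    obtain y k where y: "y \<in> omega s (B t)" "strict_mono k" "(\<lambda>n. S s (q (k n)) (x (k n))) \<longlonglongrightarrow> y"
      using omega_limit_point[where D = "B t" and x = x and s = q and t = s, OF bdd B_subset q(1) q(3)] by metis
    have "(\<lambda>n. S t s (S s (q (k n)) (x (k n)))) \<longlonglongrightarrow> S t s y"
      by (rule seqcont[OF y(3) maps[OF q(2) xX]]) (use y(1) omX[OF bdd B_subset] in blast)
    then have "(\<lambda>n. S t (q (k n)) (x (k n))) \<longlonglongrightarrow> S t s y"
      using cocycle[OF q(2) st xX] by simp
    then have "S t s y = z"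
      by (rule LIMSEQ_unique) (use LIMSEQ_subseq_LIMSEQ[OF q(4) y(2)] in \<open>simp add: o_def\<close>)
    moreover have "y \<in> omega s (B s)"
      using y(1) omega_absorbed[OF bdd B_subset order_refl] by blast
    ultimately show "z \<in> S t s ` omega s (B s)" by blast
  qed
qed

text \<open>\<open>C\<close> attracts in particular the bounded set \<open>B t\<close>, whose images
  come arbitrarily close to each point of its omega-limit.\<close>

lemma omega_minimal:
  assumes C: "closed (C t)" "pullback_attracts S X C"
  shows "omega t (B t) \<subseteq> C t"
proof
  fix z assume z: "z \<in> omega t (B t)"
  have "z \<in> closure (C t)" unfolding closure_approachable
  proof safe
    fix e :: real assume "0 < e"
    then have "eventually (\<lambda>s. \<forall>y\<in>S t s ` B t. \<exists>a\<in>C t. dist y a < e / 2) at_bot"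
      using C(2) compact_imp_bounded[OF compact_B] B_subset half_gt_zero[OF \<open>0 < e\<close>]
      unfolding pullback_attracts_def by blast
    then obtain \<sigma> where \<sigma>: "\<And>s. s \<le> \<sigma> \<Longrightarrow> \<forall>y\<in>S t s ` B t. \<exists>a\<in>C t. dist y a < e / 2"
      by (auto simp: eventually_at_bot_linorder)
    obtain s x where s: "s \<le> \<sigma>" "x \<in> B t" "dist (S t s x) z < e / 2"
      using z half_gt_zero[OF \<open>0 < e\<close>] unfolding omega_def by blast
    then obtain a where "a \<in> C t" "dist (S t s x) a < e / 2" using \<sigma> by blast
    then show "\<exists>a\<in>C t. dist a z < e"
      using s(3) dist_triangle_half_r[of "S t s x" a e z] by blast
  qed
  then show "z \<in> C t" using C(1) by simp
qed

theorem pullback_attractor_omega: "pullback_attractor S X (\<lambda>t. omega t (B t))"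
proof -
  have bdd: "bounded (B r)" for r using compact_B by (rule compact_imp_bounded)
  have sub: "omega t (B t) \<subseteq> B t" for t by (rule omega_subset_B[OF bdd B_subset order_refl])
  have "compact (omega t (B t))" for t
    using compact_Int_closed[OF compact_B[of t] closed_omega[of t "B t"]] sub
    by (simp add: Int_absorb1)
  moreover have "omega t (B t) \<subseteq> X" for t using sub B_subset by blast
  moreover have "omega t (B t) \<subseteq> C t"
    if "\<forall>t. closed (C t)" "pullback_attracts S X C" for C t
    using that omega_minimal by blast
  ultimately show ?thesis
    unfolding pullback_attractor_def
    by (simp add: omega_invariant pullback_attracts_omega)
qed

theorem bounded_past_omega: "bounded (\<Union>t\<in>{..\<tau>}. omega t (B t))"
proof -
  have bdd: "bounded (B r)" for r using compact_B by (rule compact_imp_bounded)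
  have "(\<Union>t\<in>{..\<tau>}. omega t (B t)) \<subseteq> B \<tau>"
    using omega_subset_B[OF bdd B_subset] by blast
  then show ?thesis using bdd bounded_subset by blast
qed

end

section \<open>Dissipativity\<close>

context sublinear_LC
begin

text \<open>The radius is independent of \<open>D\<close>: the 1 covers what remains of the initial
  value after time \<open>T\<close>, the other summand is the geometric bound on the
  forcing.\<close>

lemma Sf_absorbed_past:
  assumes qp: "\<And>t i j. i \<noteq> j \<Longrightarrow> 0 \<le> A t $ i $ j"
    and \<Phi>: "fundamental_matrix A \<Phi>"
    and \<alpha>: "\<alpha> > 0" and K: "K \<ge> 1"
    and decay: "\<And>s t. s \<le> t \<Longrightarrow> t \<le> 0 \<Longrightarrow>
           onorm (\<lambda>v. (\<Phi> t ** matrix_inv (\<Phi> s)) *v v) \<le> K * exp (- \<alpha> * (t - s))"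
    and C: "\<And>t. (LINT r:{t - 1..t}|lborel. norm (b r)) \<le> C"
    and D: "bounded D" "D \<subseteq> posorthant"
  shows "\<exists>T>0. \<forall>t\<le>0. \<forall>s\<ge>T. \<forall>x\<in>D. norm (Sf f t (t - s) x) \<le> 1 + K * (C / (1 - exp (- \<alpha>)))"
proof -
  obtain d0 where d0: "\<And>x. x \<in> D \<Longrightarrow> norm x \<le> d0" using D(1) unfolding bounded_iff by blast
  \<comment> \<open>At least 1, so that \<open>K * d \<ge> 1\<close> and its logarithm is
    nonnegative.\<close>
  define d where "d = max 1 d0"
  have d: "d \<ge> 1" "\<And>x. x \<in> D \<Longrightarrow> norm x \<le> d" using d0 by (auto simp: d_def le_max_iff_disj)
  have Kd: "K * d \<ge> 1" using mult_mono[OF K d(1)] K by simp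
  \<comment> \<open>After time \<open>ln (K * d) / \<alpha>\<close> the decay outweighs
    \<open>K * d\<close>; the \<open>+ 1\<close> makes \<open>T\<close> positive.\<close>
  define T where "T = ln (K * d) / \<alpha> + 1"
  have T0: "T > 0" unfolding T_def using Kd \<alpha> by (intro add_nonneg_pos divide_nonneg_pos) auto
  have "norm (Sf f t (t - s) x) \<le> 1 + K * (C / (1 - exp (- \<alpha>)))"
    if t: "t \<le> 0" and s: "s \<ge> T" and x: "x \<in> D" for t s x
  proof -
    have nx: "nonneg x" using D(2) x by (auto simp: posorthant_def)
    have "ln (K * d) = \<alpha> * (T - 1)" unfolding T_def using \<alpha> by simp
    also have "\<dots> \<le> \<alpha> * s" using s \<alpha> by (intro mult_left_mono) auto
    finally have "K * d \<le> exp (\<alpha> * s)" using Kd by (metis exp_le_cancel_iff exp_ln less_le_trans zero_less_one)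
    then have small: "K * exp (- \<alpha> * s) * d \<le> 1"
      by (simp add: exp_minus field_simps)
    have "norm (Sf f t (t - s) x) \<le> K * exp (- \<alpha> * (t - (t - s))) * norm x
        + K * (LINT q:{t - s..t}|lborel. exp (- \<alpha> * (t - q)) * norm (b q))"
      by (rule Sf_exponential_bound[OF qp \<Phi> decay _ t nx]) (use s T0 in auto)
    also have "\<dots> \<le> K * exp (- \<alpha> * s) * d + K * (C / (1 - exp (- \<alpha>)))"
    proof (rule add_mono)
      show "K * exp (- \<alpha> * (t - (t - s))) * norm x \<le> K * exp (- \<alpha> * s) * d"
        using d(2)[OF x] K by (simp add: mult_left_mono)
      show "K * (LINT q:{t - s..t}|lborel. exp (- \<alpha> * (t - q)) * norm (b q)) \<le> K * (C / (1 - exp (- \<alpha>)))"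
        using K by (intro mult_left_mono exp_weighted_integral_bound set_integrable_norm b_int \<alpha> C) auto
    qed
    finally show ?thesis using small by simp
  qed
  then show ?thesis using T0 by blast
qed

end

theorem theorem6p12:
  fixes f :: "real \<Rightarrow> real^'n \<Rightarrow> real^'n"
    and A :: "real \<Rightarrow> real^'n^'n" and b :: "real \<Rightarrow> real^'n"
    and \<Phi> :: "real \<Rightarrow> real^'n^'n"
  assumes "LC f" and "cond_A1 f"
    and "\<forall>a c. set_integrable lborel {a..c} A"
    and "\<forall>t i j. i \<noteq> j \<longrightarrow> 0 \<le> A t $ i $ j"
    and "\<forall>a c. set_integrable lborel {a..c} b"
    and "\<forall>t. nonneg (b t)"
    and "AE p in lborel \<Otimes>\<^sub>M lborel. nonneg (snd p) \<longrightarrow>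
           vle (f (fst p) (snd p)) (A (fst p) *v snd p + b (fst p))"
    and "fundamental_matrix A \<Phi>"
    and "\<exists>\<alpha>1>0. \<exists>K\<ge>1. \<forall>s t. s \<le> t \<and> t \<le> 0 \<longrightarrow>
           onorm (\<lambda>v. (\<Phi> t ** matrix_inv (\<Phi> s)) *v v) \<le> K * exp (- \<alpha>1 * (t - s))"
    and "\<forall>r>0. \<exists>C. \<forall>t. (LINT s:{-r..r}|lborel. norm (b (s + t))) \<le> C"
  shows "(\<forall>\<tau>. strongly_pullback_bounded_dissipative (Sf f) posorthant \<tau>) \<and>
         (\<exists>\<A>. pullback_attractor (Sf f) posorthant \<A> \<and>
              (\<forall>\<tau>. bounded (\<Union>t\<in>{..\<tau>}. \<A> t)))"
proof -
  interpret sublinear_LC f A b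
    using assms by unfold_locales auto
  obtain \<alpha> K where \<alpha>: "\<alpha> > 0" and K: "K \<ge> 1" and decay: "\<And>s t. s \<le> t \<Longrightarrow> t \<le> 0 \<Longrightarrow>
      onorm (\<lambda>v. (\<Phi> t ** matrix_inv (\<Phi> s)) *v v) \<le> K * exp (- \<alpha> * (t - s))"
    using assms(9) by blast
  have qp: "\<And>t i j. i \<noteq> j \<Longrightarrow> 0 \<le> A t $ i $ j" using assms(4) by blast
  \<comment> \<open>(A4) with radius 1: these windows of length 2 contain the unit windows of the
    geometric estimate.\<close>
  obtain C where C': "\<And>t. (LINT s:{-1..1}|lborel. norm (b (s + t))) \<le> C"
    using assms(10)[rule_format, of 1] by auto
  have nb: "set_integrable lborel {a..c} (\<lambda>r. norm (b r))" for a c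
    by (rule set_integrable_norm[OF b_int])
  have nb0: "0 \<le> (LINT r:{a..c}|lborel. norm (b r))" for a c
    by (rule set_integral_nonneg_Icc) auto
  have C: "(LINT r:{t - 1..t}|lborel. norm (b r)) \<le> C" for t
  proof -
    have "(LINT r:{t - 1..t}|lborel. norm (b r)) \<le> (LINT r:{t - 1..t + 1}|lborel. norm (b r))"
      using set_integral_Icc_split[OF nb, of "t - 1" t "t + 1"] nb0[of t "t + 1"] by simp
    also have "\<dots> \<le> C"
      using C'[of t] set_integral_translate[of "-1" 1 "\<lambda>r. norm (b r)" t] by (simp add: add.commute)
    finally show ?thesis .
  qed
  define R0 where "R0 = 1 + K * (C / (1 - exp (- \<alpha>)))"
  have "0 \<le> C" using nb0 C[of 0] by (rule order_trans)
  then have R0: "0 \<le> R0" unfolding R0_def using K \<alpha> by (intro add_nonneg_nonneg mult_nonneg_nonneg divide_nonneg_nonneg) auto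
  have "\<exists>R\<ge>0. \<forall>D. bounded D \<and> D \<subseteq> posorthant \<longrightarrow>
      (\<exists>T>0. \<forall>t\<le>\<tau>. \<forall>s\<ge>T. Sf f t (t - s) ` D \<subseteq> posorthant \<inter> cball 0 R)" for \<tau>
  proof -
    obtain M where M1: "M \<ge> 1" and M: "\<And>x0 u. \<lbrakk>nonneg x0; u \<in> {0..\<tau>}\<rbrakk>
        \<Longrightarrow> norm (Sf f u 0 x0) \<le> M * (norm x0 + (LINT r:{0..\<tau>}|lborel. norm (b r)))"
      using Sf_bound[of 0 \<tau>] by blast
    \<comment> \<open>The radius valid up to time 0, or its enlargement by Gronwall growth over
      \<open>{0..\<tau>}\<close>. For \<open>\<tau> < 0\<close> the interval is empty and the
      maximum is still at least \<open>R0\<close>.\<close>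
    define R where "R = max R0 (M * (R0 + (LINT r:{0..\<tau>}|lborel. norm (b r))))"
    have "\<exists>T>0. \<forall>t\<le>\<tau>. \<forall>s\<ge>T. Sf f t (t - s) ` D \<subseteq> posorthant \<inter> cball 0 R"
      if D: "bounded D" "D \<subseteq> posorthant" for D
    proof -
      obtain T where T0: "T > 0" and T: "\<And>t s x. t \<le> 0 \<Longrightarrow> s \<ge> T \<Longrightarrow> x \<in> D \<Longrightarrow> norm (Sf f t (t - s) x) \<le> R0"
        using Sf_absorbed_past[OF qp assms(8) \<alpha> K decay C D] unfolding R0_def by blast
      \<comment> \<open>For \<open>t > 0\<close> the orbit must already be absorbed at time 0, that
        is \<open>s - t \<ge> T\<close>; since \<open>t \<le> \<tau>\<close>, the extra
        \<open>max 0 \<tau>\<close> guarantees it.\<close>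
      have "Sf f t (t - s) x \<in> posorthant \<inter> cball 0 R"
        if t: "t \<le> \<tau>" and s: "s \<ge> T + max 0 \<tau>" and x: "x \<in> D" for t s x
      proof -
        have nx: "nonneg x" using D(2) x by (auto simp: posorthant_def)
        have "norm (Sf f t (t - s) x) \<le> R"
        proof (cases "t \<le> 0")
          case True
          then have "norm (Sf f t (t - s) x) \<le> R0" using s by (intro T x) auto
          then show ?thesis by (simp add: R_def)
        next
          case False
          have le: "t - s \<le> 0" using t s T0 by linarith
          define z where "z = Sf f 0 (t - s) x"
          have "norm (Sf f 0 (0 - (s - t)) x) \<le> R0" using s t False by (intro T x) auto
          then have z: "norm z \<le> R0" by (simp add: z_def)
          have "nonneg z" unfolding z_def by (rule Sf_nonneg[OF le nx])
          then have "norm (Sf f t 0 z) \<le> M * (norm z + (LINT r:{0..\<tau>}|lborel. norm (b r)))"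
            using False t by (intro M) auto
          also have "\<dots> \<le> M * (R0 + (LINT r:{0..\<tau>}|lborel. norm (b r)))"
            using z M1 by (intro mult_left_mono) auto
          also have "\<dots> \<le> R" by (simp add: R_def)
          finally show ?thesis
            using Sf_cocycle[OF le _ nx, of t] False by (simp add: z_def)
        qed
        moreover have "nonneg (Sf f t (t - s) x)" using s T0 by (intro Sf_nonneg nx) auto
        ultimately show ?thesis by (simp add: posorthant_def)
      qed
      moreover have "T + max 0 \<tau> > 0" using T0 by simp
      ultimately show ?thesis by blast
    qed
    moreover have "0 \<le> R" using R0 by (simp add: R_def)
    ultimately show ?thesis by blast
  qed
  then obtain R where R0: "\<And>\<tau>. 0 \<le> R \<tau>" and R: "\<And>\<tau> D. bounded D \<Longrightarrow> D \<subseteq> posorthant \<Longrightarrow>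
      \<exists>T>0. \<forall>t\<le>\<tau>. \<forall>s\<ge>T. Sf f t (t - s) ` D \<subseteq> posorthant \<inter> cball 0 (R \<tau>)"
    by metis
  \<comment> \<open>Truncating the closed orthant by a ball makes \<open>B \<tau>\<close> compact,
    and it contains 0, so it is nonempty as an absorbing family must be.\<close>
  define B where "B = (\<lambda>\<tau>. posorthant \<inter> cball (0 :: real^'n) (R \<tau>))"
  interpret dissipative_process "Sf f" posorthant B
  proof
    show "compact (B t)" for t
      unfolding B_def by (intro closed_Int_compact closed_posorthant compact_cball)
    show "\<exists>T>0. \<forall>t\<le>\<tau>. \<forall>s\<ge>T. Sf f t (t - s) ` D \<subseteq> B \<tau>" if "bounded D" "D \<subseteq> posorthant" for D \<tau>
      unfolding B_def by (rule R[OF that])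
  qed (auto simp: B_def posorthant_def Sf_nonneg intro: Sf_cocycle continuous_on_Sf[unfolded posorthant_def])
  have "0 \<in> B t" for t using R0 by (simp add: B_def posorthant_def nonneg_def)
  then have "pullback_absorbing (Sf f) posorthant B"
    unfolding pullback_absorbing_def
    using B_subset compact_imp_bounded[OF compact_B] absorbing by (metis empty_iff order_refl)
  then have "strongly_pullback_bounded_dissipative (Sf f) posorthant \<tau>" for \<tau>
    unfolding strongly_pullback_bounded_dissipative_def using absorbing by blast
  then show ?thesis using pullback_attractor_omega bounded_past_omega by blast
qed

end
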